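(* Let $(\Gamma,\mu,\pi)$ be a graph with pages $\Gamma_1,\dots,\Gamma_l$ and spine $\Gamma_0$. Assume the spine $\Gamma_0$ has fixed width $\delta>0$ and that each page $\Gamma_i$ is uniform in $\Gamma$. Moreover, assume each page $\Gamma_i$ has a relative Faber-Krahn function $\Lambda_i$, $1\le i\le l$. Then there exist constants $a_1,a_2,c_1,c_2,c_3>0$ such that a relative Faber-Krahn function of $\Gamma$ is given, for balls $B=B(z,r)\subset\Gamma$ and $\nu>0$, by $$\Lambda(B,\nu):=\begin{cases}a_1\Lambda_i(B,a_2\nu)&\text{if }B\subset\Gamma_i\text{ for some }i=1,\dots,l,\\ \overline\Lambda(B,\nu)&\text{otherwise,}\end{cases}$$ where $$\overline\Lambda(B,\nu):=c_1\min_{i\in J_B}\ \min_{\alpha\in[B]_\delta\cap\Gamma_i\cap[\Gamma_0]_\delta}\Lambda_i\big(B_i(\alpha,c_2r),c_3\nu\big),\qquad J_B:=\{1\le i\le l: B\cap\widehat\Gamma_i\neq\emptyset\},$$ and $\widehat\Gamma_i:=[\Gamma_i]_\delta\cap(\Gamma_i\cup\Gamma_0)$ is the augmented page.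
   Context: **Weighted graphs.** Graphs are simple (no loops, no multiple edges) and connected unless stated otherwise. A graph $\Gamma=(V,E)$ carries vertex weights $\pi>0$ and symmetric edge weights $\mu_{xy}=\mu_{yx}\ge 0$ with $\mu_{xy}\neq0\iff\{x,y\}\in E$ (adapted) and $\sum_{y\sim x}\mu_{xy}\le\pi(x)$ (subordinate). Standing assumptions: controlled weights (there is $C_c>1$ with $\mu_{xy}/\pi(x)\ge 1/C_c$ whenever $y\sim x$) and uniform laziness (there is $C_e\in(0,1)$ with $\sum_{y\sim x}\mu_{xy}\le(1-C_e)\pi(x)$ for all $x$). $d=d_\Gamma$ is graph distance, $B(x,r)=\{y:d(x,y)\le r\}$, and $[A]_s=\{y\in\Gamma:d_\Gamma(y,A)\le s\}$. $B_i$ denotes a ball in the page $\Gamma_i$ with respect to the graph distance $d_i$ of $\Gamma_i$; when $B=B(z,r)\subset\Gamma_i$ then $B$ is regarded as the ball $B_i(z,r)$ of $\Gamma_i$ in $\Lambda_i(B,\cdot)$ (if several $i$ qualify, any one, chosen depending only on $B$, may be used). **Graph with pages and spine.** Such a graph is obtained by gluing or by cutting. Gluing: let $(\Gamma_i,\pi_i,\mu^i)$, $1\le i\le l$, be infinite graphs (pages) with marked vertex sets $G_i\subset\Gamma_i$, and let $(\Gamma_0,\pi_0,\mu^0)$ be a graph (spine), possibly disconnected, with symmetric, adapted, subordinate, controlled and uniformly lazy weights, containing (not necessarily disjoint) vertex sets $G_i'$ with bijections $G_i\leftrightarrow G_i'$. Identified vertices $x\in G_i$, $x'\in G_i'$ satisfy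 $c_I\pi_0(x')\le\pi_i(x)\le C_I\pi_0(x')$ with uniform constants $c_I,C_I>0$. (A vertex $x'$ with no neighbors in $\Gamma_0$ is also allowed to have $\pi_0(x')=0$; then instead $c_I\pi_j(x_j)\le\pi_i(x_i)\le C_I\pi_j(x_j)$ is required whenever $x_i\in\Gamma_i$, $x_j\in\Gamma_j$ are both identified with $x'$.) $\Gamma$ is the graph obtained by making these identifications, with $\pi=\sum_{i=0}^l\pi_i$, $\mu=\sum_{i=0}^l\mu^i$ (terms being $0$ where undefined). It is required that $\Gamma$ is connected; that $[\Gamma_0]_\alpha$ is connected in $\Gamma$ for some $\alpha>0$; and that, in $\Gamma$, the inner boundary $\partial_I\Gamma_i=\{x\in\Gamma_i:\exists y\in\Gamma\setminus\Gamma_i,\ y\sim x\}$ equals $G_i$ for $1\le i\le l$. Cutting: start from $(\Gamma,\pi,\mu)$ and a vertex set $\Gamma_0$ whose removal leaves finitely many connected components, all infinite; the page $\Gamma_i$ is the $i$-th component together with the set $G_i\subset\Gamma_0$ of vertices adjacent to it; pages and spine carry weights comparable to those of $\Gamma$ ($c_B\pi\le\pi_i\le C_B\pi$ on $\Gamma_i$, similarly for edge weights; $\pi_0=0$ allowed at vertices isolated in $\Gamma_0$); $\Gamma_0$ is $\alpha$-connected in $\Gamma$, and every vertex of $\Gamma_0$ either has all neighbors in $\Gamma_0$ or has neighbors in $\Gamma_i$ and $\Gamma_j$ for some $i\neq j$ in $\{0,\dots,l\}$. **Fixed width.** The spine has fixed width $\delta>0$ if for every $v\in\Gamma_0$ there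 is $i\in\{1,\dots,l\}$ with $d_\Gamma(v,\Gamma_i)\le\delta$. **Uniform.** A subgraph $\Gamma'$ of $\widehat\Gamma$ is uniform in $\widehat\Gamma$ if there are $0<c_u,C_U<\infty$ such that any $x,y\in\Gamma'$ are joined by a path $(x_0=x,\dots,x_k=y)$ in $\Gamma'$ with $k\le C_Ud_{\widehat\Gamma}(x,y)$ and $d_{\widehat\Gamma}(x_j,\widehat\Gamma\setminus\Gamma')\ge c_u(1+\min\{j,k-j\})$ for $0\le j\le k$. **Relative Faber-Krahn function.** For an infinite weighted graph $\Gamma$, a function $(B,\nu)\mapsto\Lambda(B,\nu)$ of balls $B=B(z,r)$ and $\nu\in(0,\infty)$ is a relative Faber-Krahn function of $\Gamma$ if (1) $\nu\mapsto\Lambda(B,\nu)$ is non-increasing and (2) for every ball $B$ and every nonempty $\Omega\subset B$, $\lambda_1(\Omega)\ge\Lambda(B,\pi(\Omega))$, where $$\lambda_1(\Omega)=\inf_{f\ne0,\ \operatorname{supp}f\subseteq\Omega}\frac{\frac12\sum_{x,y\in\Gamma}|f(x)-f(y)|^2\mu_{xy}}{\sum_{x\in\Gamma}|f(x)|^2\pi(x)}.$$ *)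

theory Defs
  imports "HOL-Analysis.Analysis"
begin

section \<open>Weighted graphs\<close>

text \<open>Weights and edges are only meaningful on the vertex set; their values elsewhere are never used.\<close>

record 'v wgraph =
  verts :: "'v set"
  edges :: "'v set set"
  vwt :: "'v \<Rightarrow> real"
  ewt :: "'v \<Rightarrow> 'v \<Rightarrow> real"

definition adj :: "'v wgraph \<Rightarrow> 'v \<Rightarrow> 'v \<Rightarrow> bool" where
  "adj \<Gamma> x y \<longleftrightarrow> {x, y} \<in> edges \<Gamma>"

definition nbrs :: "'v wgraph \<Rightarrow> 'v \<Rightarrow> 'v set" where
  "nbrs \<Gamma> x = {y \<in> verts \<Gamma>. adj \<Gamma> x y}"

definition simple_graph :: "'v wgraph \<Rightarrow> bool" where
  "simple_graph \<Gamma> \<longleftrightarrow>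
     (\<forall>e\<in>edges \<Gamma>. \<exists>x\<in>verts \<Gamma>. \<exists>y\<in>verts \<Gamma>. x \<noteq> y \<and> e = {x, y})"

text \<open>\<open>path_in \<Gamma> S k p\<close>: \<open>(p 0, \<dots>, p k)\<close> is a path of length \<open>k\<close> in \<open>\<Gamma>\<close> with all vertices in \<open>S\<close>.\<close>

definition path_in :: "'v wgraph \<Rightarrow> 'v set \<Rightarrow> nat \<Rightarrow> (nat \<Rightarrow> 'v) \<Rightarrow> bool" where
  "path_in \<Gamma> S k p \<longleftrightarrow>
     (\<forall>j\<le>k. p j \<in> verts \<Gamma> \<and> p j \<in> S) \<and> (\<forall>j<k. adj \<Gamma> (p j) (p (Suc j)))"

definition joined_in :: "'v wgraph \<Rightarrow> 'v set \<Rightarrow> 'v \<Rightarrow> 'v \<Rightarrow> bool" where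
  "joined_in \<Gamma> S x y \<longleftrightarrow> (\<exists>k p. path_in \<Gamma> S k p \<and> p 0 = x \<and> p k = y)"

definition connected_in :: "'v wgraph \<Rightarrow> 'v set \<Rightarrow> bool" where
  "connected_in \<Gamma> S \<longleftrightarrow> (\<forall>x\<in>S. \<forall>y\<in>S. joined_in \<Gamma> S x y)"

definition components_in :: "'v wgraph \<Rightarrow> 'v set \<Rightarrow> 'v set set" where
  "components_in \<Gamma> S = {{y. joined_in \<Gamma> S x y} |x. x \<in> S}"

text \<open>Graph distance; only used in connected graphs, where the set below is nonempty.\<close>

definition gdist :: "'v wgraph \<Rightarrow> 'v \<Rightarrow> 'v \<Rightarrow> nat" where
  "gdist \<Gamma> x y = Inf {k. \<exists>p. path_in \<Gamma> (verts \<Gamma>) k p \<and> p 0 = x \<and> p k = y}"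

definition gball :: "'v wgraph \<Rightarrow> 'v \<Rightarrow> real \<Rightarrow> 'v set" where
  "gball \<Gamma> x r = {y \<in> verts \<Gamma>. real (gdist \<Gamma> x y) \<le> r}"

text \<open>Distances are natural numbers, so the distance to a nonempty set is attained, and
  \<open>d(y, A) \<le> s\<close> means that some point of \<open>A\<close> is within distance \<open>s\<close> of \<open>y\<close>.\<close>

definition nbhd :: "'v wgraph \<Rightarrow> 'v set \<Rightarrow> real \<Rightarrow> 'v set" where
  "nbhd \<Gamma> A s = {y \<in> verts \<Gamma>. \<exists>a\<in>A. real (gdist \<Gamma> y a) \<le> s}"

definition adapted :: "'v wgraph \<Rightarrow> bool" where
  "adapted \<Gamma> \<longleftrightarrow>
     (\<forall>x\<in>verts \<Gamma>. \<forall>y\<in>verts \<Gamma>. ewt \<Gamma> x y = ewt \<Gamma> y x \<and> 0 \<le> ewt \<Gamma> x y \<and>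
        (ewt \<Gamma> x y \<noteq> 0 \<longleftrightarrow> adj \<Gamma> x y))"

text \<open>Summability is part of the inequality \<open>\<Sum>\<^sub>y \<mu>\<^sub>x\<^sub>y \<le> \<pi>(x)\<close>: \<^const>\<open>infsum\<close> of a
  non-summable family is \<open>0\<close>.\<close>

definition subordinate :: "'v wgraph \<Rightarrow> bool" where
  "subordinate \<Gamma> \<longleftrightarrow>
     (\<forall>x\<in>verts \<Gamma>. ewt \<Gamma> x summable_on nbrs \<Gamma> x \<and> (\<Sum>\<^sub>\<infinity>y\<in>nbrs \<Gamma> x. ewt \<Gamma> x y) \<le> vwt \<Gamma> x)"

definition controlled :: "'v wgraph \<Rightarrow> bool" where
  "controlled \<Gamma> \<longleftrightarrow>
     (\<exists>Cc>1. \<forall>x\<in>verts \<Gamma>. \<forall>y\<in>nbrs \<Gamma> x. ewt \<Gamma> x y / vwt \<Gamma> x \<ge> 1 / Cc)"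

definition uniformly_lazy :: "'v wgraph \<Rightarrow> bool" where
  "uniformly_lazy \<Gamma> \<longleftrightarrow>
     (\<exists>Ce. 0 < Ce \<and> Ce < 1 \<and>
        (\<forall>x\<in>verts \<Gamma>. ewt \<Gamma> x summable_on nbrs \<Gamma> x \<and>
           (\<Sum>\<^sub>\<infinity>y\<in>nbrs \<Gamma> x. ewt \<Gamma> x y) \<le> (1 - Ce) * vwt \<Gamma> x))"

definition admissible_weights :: "'v wgraph \<Rightarrow> bool" where
  "admissible_weights \<Gamma> \<longleftrightarrow>
     adapted \<Gamma> \<and> subordinate \<Gamma> \<and> controlled \<Gamma> \<and> uniformly_lazy \<Gamma>"

definition weighted_graph :: "'v wgraph \<Rightarrow> bool" where
  "weighted_graph \<Gamma> \<longleftrightarrow>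
     simple_graph \<Gamma> \<and> connected_in \<Gamma> (verts \<Gamma>) \<and> (\<forall>x\<in>verts \<Gamma>. 0 < vwt \<Gamma> x) \<and>
     admissible_weights \<Gamma>"

definition spine_graph :: "'v wgraph \<Rightarrow> bool" where
  "spine_graph \<Gamma> \<longleftrightarrow>
     simple_graph \<Gamma> \<and>
     (\<forall>x\<in>verts \<Gamma>. 0 < vwt \<Gamma> x \<or> (vwt \<Gamma> x = 0 \<and> nbrs \<Gamma> x = {})) \<and>
     admissible_weights \<Gamma>"

section \<open>Graphs with pages and spine\<close>

text \<open>Throughout, a family \<open>P\<close> of graphs on subsets of the vertex set of \<open>\<Gamma>\<close> lists the spine
  \<open>P 0\<close> and the pages \<open>P 1, \<dots>, P l\<close>.\<close>

definition inner_boundary :: "'v wgraph \<Rightarrow> 'v set \<Rightarrow> 'v set" where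
  "inner_boundary \<Gamma> A = {x \<in> A. \<exists>y \<in> verts \<Gamma> - A. adj \<Gamma> y x}"

definition wgraph_iso :: "('v \<Rightarrow> 'w) \<Rightarrow> 'v wgraph \<Rightarrow> 'w wgraph \<Rightarrow> bool" where
  "wgraph_iso h Q P \<longleftrightarrow>
     bij_betw h (verts Q) (verts P) \<and> edges P = (\<lambda>e. h ` e) ` edges Q \<and>
     (\<forall>x\<in>verts Q. vwt P (h x) = vwt Q x) \<and>
     (\<forall>x\<in>verts Q. \<forall>y\<in>verts Q. ewt P (h x) (h y) = ewt Q x y)"

text \<open>The pair \<open>(i, x)\<close> stands for the vertex \<open>x\<close> of the \<open>i\<close>-th graph in the disjoint union;
  two such pairs are identified in the gluing iff they have the same image under \<open>glue_rep\<close>,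
  which sends a marked vertex of a page to its partner in the spine.\<close>

definition glue_rep :: "(nat \<Rightarrow> 'v set) \<Rightarrow> (nat \<Rightarrow> 'v \<Rightarrow> 'v) \<Rightarrow> nat \<Rightarrow> 'v \<Rightarrow> nat \<times> 'v" where
  "glue_rep G \<phi> i x = (if 1 \<le> i \<and> x \<in> G i then (0, \<phi> i x) else (i, x))"

definition glue_comparable ::
  "nat \<Rightarrow> (nat \<Rightarrow> 'v wgraph) \<Rightarrow> (nat \<Rightarrow> 'v set) \<Rightarrow> (nat \<Rightarrow> 'v \<Rightarrow> 'v) \<Rightarrow> bool" where
  "glue_comparable l Q G \<phi> \<longleftrightarrow>
     (\<exists>cI>0. \<exists>CI>0. \<forall>i\<in>{1..l}. \<forall>x\<in>G i.
        if vwt (Q 0) (\<phi> i x) \<noteq> 0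
        then cI * vwt (Q 0) (\<phi> i x) \<le> vwt (Q i) x \<and> vwt (Q i) x \<le> CI * vwt (Q 0) (\<phi> i x)
        else \<forall>j\<in>{1..l}. \<forall>y\<in>G j. \<phi> j y = \<phi> i x \<longrightarrow>
               cI * vwt (Q j) y \<le> vwt (Q i) x \<and> vwt (Q i) x \<le> CI * vwt (Q j) y)"

definition is_sum_of :: "nat \<Rightarrow> 'v wgraph \<Rightarrow> (nat \<Rightarrow> 'v wgraph) \<Rightarrow> bool" where
  "is_sum_of l \<Gamma> P \<longleftrightarrow>
     verts \<Gamma> = (\<Union>i\<le>l. verts (P i)) \<and> edges \<Gamma> = (\<Union>i\<le>l. edges (P i)) \<and>
     (\<forall>x\<in>verts \<Gamma>. vwt \<Gamma> x = (\<Sum>i\<le>l. if x \<in> verts (P i) then vwt (P i) x else 0)) \<and>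
     (\<forall>x\<in>verts \<Gamma>. \<forall>y\<in>verts \<Gamma>.
        ewt \<Gamma> x y = (\<Sum>i\<le>l. if x \<in> verts (P i) \<and> y \<in> verts (P i) then ewt (P i) x y else 0))"

text \<open>\<open>Q i\<close> are the graphs before gluing and \<open>P i\<close> their copies inside \<open>\<Gamma>\<close>; the maps \<open>q i\<close>
  together form the quotient map from the disjoint union of the \<open>Q i\<close> to \<open>\<Gamma>\<close>.  Since each
  \<open>Q i\<close> embeds into \<open>\<Gamma>\<close>, letting \<open>Q i\<close> live on the vertex type of \<open>\<Gamma>\<close> is no restriction.\<close>

definition obtained_by_gluing :: "nat \<Rightarrow> 'v wgraph \<Rightarrow> (nat \<Rightarrow> 'v wgraph) \<Rightarrow> bool" where
  "obtained_by_gluing l \<Gamma> P \<longleftrightarrow>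
     (\<exists>(Q :: nat \<Rightarrow> 'v wgraph) (G :: nat \<Rightarrow> 'v set) (G' :: nat \<Rightarrow> 'v set)
       (\<phi> :: nat \<Rightarrow> 'v \<Rightarrow> 'v) (q :: nat \<Rightarrow> 'v \<Rightarrow> 'v).
        spine_graph (Q 0) \<and>
        (\<forall>i\<in>{1..l}. weighted_graph (Q i) \<and> infinite (verts (Q i)) \<and>
           G i \<subseteq> verts (Q i) \<and> G' i \<subseteq> verts (Q 0) \<and> bij_betw (\<phi> i) (G i) (G' i)) \<and>
        glue_comparable l Q G \<phi> \<and>
        (\<forall>i\<le>l. \<forall>j\<le>l. \<forall>x\<in>verts (Q i). \<forall>y\<in>verts (Q j).
           q i x = q j y \<longleftrightarrow> glue_rep G \<phi> i x = glue_rep G \<phi> j y) \<and>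
        (\<forall>i\<le>l. wgraph_iso (q i) (Q i) (P i)) \<and>
        is_sum_of l \<Gamma> P \<and>
        connected_in \<Gamma> (verts \<Gamma>) \<and>
        (\<exists>s>0. connected_in \<Gamma> (nbhd \<Gamma> (verts (P 0)) s)) \<and>
        (\<forall>i\<in>{1..l}. inner_boundary \<Gamma> (verts (P i)) = q i ` G i))"

definition obtained_by_cutting :: "nat \<Rightarrow> 'v wgraph \<Rightarrow> (nat \<Rightarrow> 'v wgraph) \<Rightarrow> bool" where
  "obtained_by_cutting l \<Gamma> P \<longleftrightarrow>
     weighted_graph \<Gamma> \<and>
     verts (P 0) \<subseteq> verts \<Gamma> \<and>
     (\<exists>K :: nat \<Rightarrow> 'v set.
        bij_betw K {1..l} (components_in \<Gamma> (verts \<Gamma> - verts (P 0))) \<and>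
        (\<forall>i\<in>{1..l}. infinite (K i) \<and>
           verts (P i) = K i \<union> {v \<in> verts (P 0). \<exists>y\<in>K i. adj \<Gamma> v y})) \<and>
     (\<forall>i\<le>l. edges (P i) = {e \<in> edges \<Gamma>. e \<subseteq> verts (P i)}) \<and>
     spine_graph (P 0) \<and> (\<forall>i\<in>{1..l}. weighted_graph (P i)) \<and>
     (\<exists>cB>0. \<exists>CB>0. \<forall>i\<le>l.
        (\<forall>x\<in>verts (P i).
           (cB * vwt \<Gamma> x \<le> vwt (P i) x \<and> vwt (P i) x \<le> CB * vwt \<Gamma> x) \<or>
           (i = 0 \<and> nbrs (P 0) x = {} \<and> vwt (P 0) x = 0)) \<and>
        (\<forall>x\<in>verts (P i). \<forall>y\<in>verts (P i).
           cB * ewt \<Gamma> x y \<le> ewt (P i) x y \<and> ewt (P i) x y \<le> CB * ewt \<Gamma> x y)) \<and>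
     (\<exists>s>0. connected_in \<Gamma> (nbhd \<Gamma> (verts (P 0)) s)) \<and>
     (\<forall>v\<in>verts (P 0). nbrs \<Gamma> v \<subseteq> verts (P 0) \<or>
        (\<exists>i\<le>l. \<exists>j\<le>l. i \<noteq> j \<and>
           nbrs \<Gamma> v \<inter> verts (P i) \<noteq> {} \<and> nbrs \<Gamma> v \<inter> verts (P j) \<noteq> {}))"

definition pages_and_spine :: "nat \<Rightarrow> 'v wgraph \<Rightarrow> (nat \<Rightarrow> 'v wgraph) \<Rightarrow> bool" where
  "pages_and_spine l \<Gamma> P \<longleftrightarrow>
     1 \<le> l \<and> (obtained_by_gluing l \<Gamma> P \<or> obtained_by_cutting l \<Gamma> P)"

definition fixed_width :: "nat \<Rightarrow> 'v wgraph \<Rightarrow> (nat \<Rightarrow> 'v wgraph) \<Rightarrow> real \<Rightarrow> bool" where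
  "fixed_width l \<Gamma> P \<delta> \<longleftrightarrow>
     (\<forall>v\<in>verts (P 0). \<exists>i\<in>{1..l}. v \<in> nbhd \<Gamma> (verts (P i)) \<delta>)"

text \<open>The lower bound on the distance to the complement is stated pointwise, so that it is
  vacuous when the complement is empty (distance \<open>\<infinity>\<close> to the empty set).\<close>

definition uniform_in :: "'v wgraph \<Rightarrow> 'v wgraph \<Rightarrow> bool" where
  "uniform_in H \<Gamma> \<longleftrightarrow>
     (\<exists>cu>0. \<exists>CU>0. \<forall>x\<in>verts H. \<forall>y\<in>verts H. \<exists>k p.
        path_in H (verts H) k p \<and> p 0 = x \<and> p k = y \<and>
        real k \<le> CU * real (gdist \<Gamma> x y) \<and>
        (\<forall>j\<le>k. \<forall>w \<in> verts \<Gamma> - verts H.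
           real (gdist \<Gamma> (p j) w) \<ge> cu * (1 + real (min j (k - j)))))"

section \<open>Relative Faber-Krahn functions\<close>

definition vmeasure :: "'v wgraph \<Rightarrow> 'v set \<Rightarrow> real" where
  "vmeasure \<Gamma> \<Omega> = (\<Sum>\<^sub>\<infinity>x\<in>\<Omega>. vwt \<Gamma> x)"

definition dirichlet_energy :: "'v wgraph \<Rightarrow> ('v \<Rightarrow> real) \<Rightarrow> real" where
  "dirichlet_energy \<Gamma> f =
     1/2 * (\<Sum>\<^sub>\<infinity>(x, y) \<in> verts \<Gamma> \<times> verts \<Gamma>. \<bar>f x - f y\<bar>\<^sup>2 * ewt \<Gamma> x y)"

definition first_eigenvalue :: "'v wgraph \<Rightarrow> 'v set \<Rightarrow> real" where
  "first_eigenvalue \<Gamma> \<Omega> =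
     (INF f \<in> {f :: 'v \<Rightarrow> real. f \<noteq> (\<lambda>_. 0) \<and> {x. f x \<noteq> 0} \<subseteq> \<Omega>}.
        dirichlet_energy \<Gamma> f / (\<Sum>\<^sub>\<infinity>x\<in>verts \<Gamma>. \<bar>f x\<bar>\<^sup>2 * vwt \<Gamma> x))"

text \<open>A ball is given by its centre and radius (which the underlying set need not determine), so
  \<open>\<Lambda> z r \<nu>\<close> is \<open>\<Lambda>(B(z, r), \<nu>)\<close>.\<close>

definition relative_FK :: "'v wgraph \<Rightarrow> ('v \<Rightarrow> real \<Rightarrow> real \<Rightarrow> real) \<Rightarrow> bool" where
  "relative_FK \<Gamma> \<Lambda> \<longleftrightarrow>
     infinite (verts \<Gamma>) \<and>
     (\<forall>z\<in>verts \<Gamma>. \<forall>r\<ge>0.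
        (\<forall>\<nu> \<nu>'. 0 < \<nu> \<and> \<nu> \<le> \<nu>' \<longrightarrow> \<Lambda> z r \<nu>' \<le> \<Lambda> z r \<nu>) \<and>
        (\<forall>\<Omega>. \<Omega> \<noteq> {} \<and> \<Omega> \<subseteq> gball \<Gamma> z r \<longrightarrow>
           first_eigenvalue \<Gamma> \<Omega> \<ge> \<Lambda> z r (vmeasure \<Gamma> \<Omega>)))"

definition augmented_page :: "'v wgraph \<Rightarrow> (nat \<Rightarrow> 'v wgraph) \<Rightarrow> real \<Rightarrow> nat \<Rightarrow> 'v set" where
  "augmented_page \<Gamma> P \<delta> i =
     nbhd \<Gamma> (verts (P i)) \<delta> \<inter> (verts (P i) \<union> verts (P 0))"

definition page_indices ::
  "nat \<Rightarrow> 'v wgraph \<Rightarrow> (nat \<Rightarrow> 'v wgraph) \<Rightarrow> real \<Rightarrow> 'v set \<Rightarrow> nat set" where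
  "page_indices l \<Gamma> P \<delta> B = {i \<in> {1..l}. B \<inter> augmented_page \<Gamma> P \<delta> i \<noteq> {}}"

text \<open>Both minima are over finite sets, which are nonempty whenever the ball lies in no page:
  graphs with controlled subordinate weights have bounded degree.\<close>

definition Lambda_bar ::
  "nat \<Rightarrow> 'v wgraph \<Rightarrow> (nat \<Rightarrow> 'v wgraph) \<Rightarrow> real \<Rightarrow> (nat \<Rightarrow> 'v \<Rightarrow> real \<Rightarrow> real \<Rightarrow> real) \<Rightarrow>
     real \<Rightarrow> real \<Rightarrow> real \<Rightarrow> 'v \<Rightarrow> real \<Rightarrow> real \<Rightarrow> real" where
  "Lambda_bar l \<Gamma> P \<delta> \<Lambda> c\<^sub>1 c\<^sub>2 c\<^sub>3 z r \<nu> =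
     c\<^sub>1 * (MIN i \<in> page_indices l \<Gamma> P \<delta> (gball \<Gamma> z r).
            MIN \<alpha> \<in> nbhd \<Gamma> (gball \<Gamma> z r) \<delta> \<inter> verts (P i) \<inter> nbhd \<Gamma> (verts (P 0)) \<delta>.
              \<Lambda> i \<alpha> (c\<^sub>2 * r) (c\<^sub>3 * \<nu>))"

text \<open>\<open>\<sigma> z r\<close> is the page used for a ball \<open>B(z, r)\<close> contained in at least one page.\<close>

definition page_choice ::
  "nat \<Rightarrow> 'v wgraph \<Rightarrow> (nat \<Rightarrow> 'v wgraph) \<Rightarrow> ('v \<Rightarrow> real \<Rightarrow> nat) \<Rightarrow> bool" where
  "page_choice l \<Gamma> P \<sigma> \<longleftrightarrow>
     (\<forall>z r. (\<exists>i\<in>{1..l}. gball \<Gamma> z r \<subseteq> verts (P i)) \<longrightarrow>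
        \<sigma> z r \<in> {1..l} \<and> gball \<Gamma> z r \<subseteq> verts (P (\<sigma> z r)))"

end

theory Submission
  imports Defs
begin

text \<open>
  A function \<open>f\<close> supported in a set \<open>\<Omega>\<close> is restricted to the pages: the energy of the restriction to
  a page is at most a constant times the energy of \<open>f\<close>, and the part of the \<open>L\<^sup>2\<close> norm carried by
  vertices off the pages, which are within distance \<open>\<delta>\<close> of some page, is bounded by the norm on the
  pages plus the energy, because all weights along a short path are comparable.  Hence \<open>\<lambda>\<^sub>1(\<Omega>)\<close>
  is bounded below by the smallest \<open>\<lambda>\<^sub>1(\<Omega> \<inter> \<Gamma>\<^sub>i)\<close> or by a constant.  If the ball \<open>B\<close> containing
  \<open>\<Omega>\<close> meets a page without being contained in it, \<open>B\<close> contains a boundary vertex \<open>\<alpha>\<close> of that page,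
  which belongs to the spine, and uniformity puts \<open>\<Omega> \<inter> \<Gamma>\<^sub>i\<close> inside \<open>B\<^sub>i(\<alpha>, 2 C\<^sub>U r)\<close>.
\<close>

text \<open>Write \<open>M\<close> for the minimum in \<open>Lambda_bar\<close> without its leading
  factor. Bounding the norm off the pages costs a multiple of the energy, so multiplying by
  \<open>M\<close> leaves a term \<open>M * energy\<close> on the right. To absorb it,
  \<open>M\<close> must have an upper bound that does not depend on the ball. The indicator of one
  vertex bounds every page eigenvalue by \<open>K\<^sup>2\<close>, but this helps only if
  \<open>M\<close> lies below some page eigenvalue, and \<open>\<Omega>\<close> may contain no page
  vertex at all. Fixed width then gives a page vertex within \<delta> of \<open>\<Omega>\<close>,
  possibly outside the ball, and its singleton replaces \<open>\<Omega>\<close>. Such vertices are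
  among the centres of \<open>Lambda_bar\<close> because these range over \<delta>-neighbourhoods of
  the ball and of the spine. The singleton must not be heavier than the volume passed to
  \<open>\<Lambda> i\<close>; since weights change by at most a factor \<open>C\<close> per edge,
  this leads to \<open>c\<^sub>3 = K * C ^ nat \<lfloor>\<delta>\<rfloor>\<close>. A relative
  Faber-Krahn function may be negative, so each eigenvalue estimate splits on the sign of the lower
  bound.\<close>

section \<open>Distances, finiteness and norms in graphs with controlled weights\<close>

locale controlled_graph =
  fixes \<Gamma> :: "'v wgraph" and C :: real
  assumes connected: "connected_in \<Gamma> (verts \<Gamma>)"
    and adj_verts: "adj \<Gamma> x y \<Longrightarrow> x \<in> verts \<Gamma> \<and> y \<in> verts \<Gamma>"
    and vwt_pos: "x \<in> verts \<Gamma> \<Longrightarrow> 0 < vwt \<Gamma> x"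
    and ewt_sym: "x \<in> verts \<Gamma> \<Longrightarrow> y \<in> verts \<Gamma> \<Longrightarrow> ewt \<Gamma> x y = ewt \<Gamma> y x"
    and ewt_nonneg: "x \<in> verts \<Gamma> \<Longrightarrow> y \<in> verts \<Gamma> \<Longrightarrow> 0 \<le> ewt \<Gamma> x y"
    and ewt_nonadj: "x \<in> verts \<Gamma> \<Longrightarrow> y \<in> verts \<Gamma> \<Longrightarrow> \<not> adj \<Gamma> x y \<Longrightarrow> ewt \<Gamma> x y = 0"
    and C_ge_1: "1 \<le> C"
    and ewt_lower: "adj \<Gamma> x y \<Longrightarrow> vwt \<Gamma> x \<le> C * ewt \<Gamma> x y"
    and ewt_sum_le: "x \<in> verts \<Gamma> \<Longrightarrow> finite S \<Longrightarrow> S \<subseteq> verts \<Gamma> \<Longrightarrow> (\<Sum>y\<in>S. ewt \<Gamma> x y) \<le> vwt \<Gamma> x"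
begin

text \<open>Edges as a relation: walks of length \<open>k\<close> become powers
  \<open>arcs ^^ k\<close>, so concatenation is \<open>relpow_add\<close> and no path functions have
  to be spliced.\<close>

definition arcs :: "('v \<times> 'v) set" where
  "arcs = {(a, b). adj \<Gamma> a b}"

lemma arcs_iff [simp]: "(a, b) \<in> arcs \<longleftrightarrow> adj \<Gamma> a b"
  by (simp add: arcs_def)

lemma adj_commute: "adj \<Gamma> x y \<longleftrightarrow> adj \<Gamma> y x"
  by (simp add: adj_def insert_commute)

lemma path_iff_relpow:
  assumes "x \<in> verts \<Gamma>"
  shows "(\<exists>p. path_in \<Gamma> (verts \<Gamma>) k p \<and> p 0 = x \<and> p k = y) \<longleftrightarrow> (x, y) \<in> arcs ^^ k"
proof
  assume "\<exists>p. path_in \<Gamma> (verts \<Gamma>) k p \<and> p 0 = x \<and> p k = y"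
  then show "(x, y) \<in> arcs ^^ k"
    unfolding relpow_fun_conv path_in_def by auto
next
  assume "(x, y) \<in> arcs ^^ k"
  then obtain p where p: "p 0 = x" "p k = y" "\<And>j. j < k \<Longrightarrow> adj \<Gamma> (p j) (p (Suc j))"
    unfolding relpow_fun_conv by auto
  have "p j \<in> verts \<Gamma>" if "j \<le> k" for j
  proof (cases j)
    case 0 then show ?thesis using p(1) assms by simp
  next
    case (Suc i) then show ?thesis using p(3)[of i] adj_verts that by auto
  qed
  then show "\<exists>p. path_in \<Gamma> (verts \<Gamma>) k p \<and> p 0 = x \<and> p k = y"
    using p unfolding path_in_def by auto
qed

lemma gdist_eq: "x \<in> verts \<Gamma> \<Longrightarrow> gdist \<Gamma> x y = Inf {k. (x, y) \<in> arcs ^^ k}"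
  by (simp add: gdist_def path_iff_relpow)

lemma gdist_le: "x \<in> verts \<Gamma> \<Longrightarrow> (x, y) \<in> arcs ^^ k \<Longrightarrow> gdist \<Gamma> x y \<le> k"
  by (simp add: gdist_eq cInf_lower)

lemma gdist_walk:
  assumes "x \<in> verts \<Gamma>" "y \<in> verts \<Gamma>"
  shows "(x, y) \<in> arcs ^^ gdist \<Gamma> x y"
proof -
  have "\<exists>k. (x, y) \<in> arcs ^^ k"
    using connected assms path_iff_relpow unfolding connected_in_def joined_in_def by blast
  then have "Inf {k. (x, y) \<in> arcs ^^ k} \<in> {k. (x, y) \<in> arcs ^^ k}"
    by (intro Inf_nat_def1) auto
  then show ?thesis using assms by (simp add: gdist_eq)
qed

lemma gdist_self [simp]: "x \<in> verts \<Gamma> \<Longrightarrow> gdist \<Gamma> x x = 0"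
  using gdist_le[of x x 0] by simp

lemma relpow_arcs_sym: "(x, y) \<in> arcs ^^ k \<Longrightarrow> (y, x) \<in> arcs ^^ k"
proof (induction k arbitrary: y)
  case (Suc k)
  then obtain w where "(x, w) \<in> arcs ^^ k" "(w, y) \<in> arcs" by auto
  then show ?case using Suc.IH relpow_Suc_I2 adj_commute arcs_iff by metis
qed auto

lemma gdist_commute: "x \<in> verts \<Gamma> \<Longrightarrow> y \<in> verts \<Gamma> \<Longrightarrow> gdist \<Gamma> x y = gdist \<Gamma> y x"
  by (meson antisym gdist_le gdist_walk relpow_arcs_sym)

lemma gdist_triangle:
  assumes "x \<in> verts \<Gamma>" "y \<in> verts \<Gamma>" "z \<in> verts \<Gamma>"
  shows "gdist \<Gamma> x z \<le> gdist \<Gamma> x y + gdist \<Gamma> y z"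
proof (rule gdist_le)
  show "(x, z) \<in> arcs ^^ (gdist \<Gamma> x y + gdist \<Gamma> y z)"
    unfolding relpow_add using assms gdist_walk by blast
qed (use assms in auto)

lemma gdist_adj:
  assumes "x \<in> verts \<Gamma>" "adj \<Gamma> y z"
  shows "gdist \<Gamma> x z \<le> gdist \<Gamma> x y + 1"
proof -
  have "(x, z) \<in> arcs ^^ Suc (gdist \<Gamma> x y)"
    using assms gdist_walk[of x y] adj_verts by auto
  then show ?thesis using gdist_le assms by fastforce
qed

lemma ewt_le_vwt: "x \<in> verts \<Gamma> \<Longrightarrow> y \<in> verts \<Gamma> \<Longrightarrow> ewt \<Gamma> x y \<le> vwt \<Gamma> x"
  using ewt_sum_le[of x "{y}"] by simp

text \<open>The weight of the joining edge is at least \<open>vwt \<Gamma> x / C\<close> and, by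
  symmetry, at most \<open>vwt \<Gamma> y\<close>.\<close>

lemma vwt_adj_le: "adj \<Gamma> x y \<Longrightarrow> vwt \<Gamma> x \<le> C * vwt \<Gamma> y"
  using ewt_lower[of x y] ewt_le_vwt[of y x] ewt_sym[of x y] adj_verts[of x y] C_ge_1
  by (smt (verit) mult_left_mono)

lemma vwt_walk_le: "(x, y) \<in> arcs ^^ k \<Longrightarrow> vwt \<Gamma> x \<le> C ^ k * vwt \<Gamma> y"
proof (induction k arbitrary: y)
  case (Suc k)
  then obtain w where w: "(x, w) \<in> arcs ^^ k" "adj \<Gamma> w y" by auto
  have "vwt \<Gamma> x \<le> C ^ k * vwt \<Gamma> w" using Suc.IH w by simp
  also have "\<dots> \<le> C ^ k * (C * vwt \<Gamma> y)"
    using vwt_adj_le w C_ge_1 by (intro mult_left_mono) auto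
  finally show ?case by (simp add: algebra_simps)
qed auto

text \<open>Every neighbour takes at least the fraction \<open>1 / C\<close> of
  \<open>vwt \<Gamma> x\<close>, and the edge weights at \<open>x\<close> sum to at most that
  weight, so there are at most \<open>C\<close> neighbours. Finiteness of balls, and with it the
  reduction of infinite sums to finite ones, rests on this.\<close>

lemma finite_nbrs:
  assumes "x \<in> verts \<Gamma>"
  shows "finite (nbrs \<Gamma> x)"
proof (rule ccontr)
  assume "infinite (nbrs \<Gamma> x)"
  then obtain S where S: "finite S" "card S = nat \<lceil>C\<rceil> + 1" "S \<subseteq> nbrs \<Gamma> x"
    using infinite_arbitrarily_large by blast
  have "real (card S) * vwt \<Gamma> x = (\<Sum>y\<in>S. vwt \<Gamma> x)" by simp
  also have "\<dots> \<le> (\<Sum>y\<in>S. C * ewt \<Gamma> x y)"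
    using S by (intro sum_mono ewt_lower) (auto simp: nbrs_def)
  also have "\<dots> \<le> C * vwt \<Gamma> x"
    using ewt_sum_le[OF assms S(1)] S C_ge_1
    by (auto simp flip: sum_distrib_left intro!: mult_left_mono simp: nbrs_def)
  finally have "real (card S) \<le> C" using vwt_pos[OF assms] by simp
  then show False using S(2) by linarith
qed

lemma finite_gdist_le:
  assumes "x \<in> verts \<Gamma>"
  shows "finite {y \<in> verts \<Gamma>. gdist \<Gamma> x y \<le> k}"
proof (induction k)
  case 0
  have "{y \<in> verts \<Gamma>. gdist \<Gamma> x y \<le> 0} \<subseteq> {x}"
    using gdist_walk[OF assms] by fastforce
  then show ?case using finite_subset by blast
next
  case (Suc k)
  let ?B = "{y \<in> verts \<Gamma>. gdist \<Gamma> x y \<le> k}"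
  have "y \<in> ?B \<union> (\<Union>w\<in>?B. nbrs \<Gamma> w)" if y: "y \<in> verts \<Gamma>" "gdist \<Gamma> x y \<le> Suc k" for y
  proof (cases "gdist \<Gamma> x y \<le> k")
    case False
    then have "(x, y) \<in> arcs ^^ Suc k"
      using gdist_walk[OF assms y(1)] y(2) by (simp add: le_Suc_eq)
    then obtain w where w: "(x, w) \<in> arcs ^^ k" "adj \<Gamma> w y" by auto
    then have "w \<in> ?B" using gdist_le assms adj_verts by auto
    then show ?thesis using w y by (auto simp: nbrs_def)
  qed (use y in auto)
  then have "{y \<in> verts \<Gamma>. gdist \<Gamma> x y \<le> Suc k} \<subseteq> ?B \<union> (\<Union>w\<in>?B. nbrs \<Gamma> w)" by blast
  moreover have "finite (?B \<union> (\<Union>w\<in>?B. nbrs \<Gamma> w))"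
    using Suc finite_nbrs by auto
  ultimately show ?case using finite_subset by blast
qed

lemma finite_gball:
  assumes "x \<in> verts \<Gamma>"
  shows "finite (gball \<Gamma> x r)"
proof -
  have "gball \<Gamma> x r \<subseteq> {y \<in> verts \<Gamma>. gdist \<Gamma> x y \<le> nat \<lfloor>r\<rfloor>}"
    by (auto simp: gball_def le_nat_floor)
  then show ?thesis using finite_gdist_le[OF assms] finite_subset by blast
qed

lemma finite_nbhd:
  assumes "finite A" "A \<subseteq> verts \<Gamma>"
  shows "finite (nbhd \<Gamma> A s)"
proof -
  have "nbhd \<Gamma> A s \<subseteq> (\<Union>a\<in>A. gball \<Gamma> a s)"
    using assms gdist_commute unfolding nbhd_def gball_def by fastforce
  then show ?thesis using assms finite_gball by (meson finite_UN_I finite_subset subsetD)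
qed

text \<open>The edge joining \<open>v \<in> M\<close> to \<open>N\<close> has weight comparable to the weight of \<open>v\<close>; summing over
  all such edges instead of selecting one makes multiplicity bounds unnecessary.\<close>

lemma l2_shell_le:
  fixes f :: "'v \<Rightarrow> real"
  assumes A: "finite A" "A \<subseteq> verts \<Gamma>"
    and closed: "\<And>x y. f x \<noteq> 0 \<Longrightarrow> adj \<Gamma> x y \<Longrightarrow> y \<in> A"
    and M: "\<And>v. v \<in> M \<Longrightarrow> \<exists>w\<in>N. adj \<Gamma> v w"
  shows "(\<Sum>v\<in>A \<inter> M. (f v)\<^sup>2 * vwt \<Gamma> v) \<le>
    2 * C * ((\<Sum>v\<in>A \<inter> N. (f v)\<^sup>2 * vwt \<Gamma> v) + (\<Sum>v\<in>A. \<Sum>w\<in>A. (f v - f w)\<^sup>2 * ewt \<Gamma> v w))"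
proof -
  have nn: "0 \<le> ewt \<Gamma> v w" if "v \<in> A" "w \<in> A" for v w
    using that A ewt_nonneg by blast
  have sq: "(f v)\<^sup>2 \<le> 2 * ((f w)\<^sup>2 + (f v - f w)\<^sup>2)" for v w
    using sum_squares_ge_zero[of "f v - 2 * f w" 0] by (simp add: power2_eq_square algebra_simps)
  have "(f v)\<^sup>2 * vwt \<Gamma> v \<le> C * (\<Sum>w\<in>A \<inter> N. 2 * ((f w)\<^sup>2 + (f v - f w)\<^sup>2) * ewt \<Gamma> v w)"
    if v: "v \<in> A \<inter> M" for v
  proof (cases "f v = 0")
    case True
    then show ?thesis using nn v C_ge_1 by (auto intro!: mult_nonneg_nonneg sum_nonneg)
  next
    case False
    from v M obtain w where w: "w \<in> N" "adj \<Gamma> v w" by blast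
    then have wA: "w \<in> A \<inter> N" using closed False by blast
    have "(f v)\<^sup>2 * vwt \<Gamma> v \<le> (f v)\<^sup>2 * (C * ewt \<Gamma> v w)"
      using ewt_lower w by (intro mult_left_mono) auto
    also have "\<dots> = C * ((f v)\<^sup>2 * ewt \<Gamma> v w)" by simp
    also have "(f v)\<^sup>2 * ewt \<Gamma> v w \<le> (\<Sum>w\<in>A \<inter> N. (f v)\<^sup>2 * ewt \<Gamma> v w)"
      using wA A nn v by (intro member_le_sum) auto
    also have "\<dots> \<le> (\<Sum>w\<in>A \<inter> N. 2 * ((f w)\<^sup>2 + (f v - f w)\<^sup>2) * ewt \<Gamma> v w)"
      using nn v by (intro sum_mono mult_right_mono sq) auto
    finally show ?thesis using C_ge_1 by simp
  qed
  then have "(\<Sum>v\<in>A \<inter> M. (f v)\<^sup>2 * vwt \<Gamma> v)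
      \<le> (\<Sum>v\<in>A \<inter> M. C * (\<Sum>w\<in>A \<inter> N. 2 * ((f w)\<^sup>2 + (f v - f w)\<^sup>2) * ewt \<Gamma> v w))"
    by (intro sum_mono)
  also have "\<dots> \<le> (\<Sum>v\<in>A. C * (\<Sum>w\<in>A \<inter> N. 2 * ((f w)\<^sup>2 + (f v - f w)\<^sup>2) * ewt \<Gamma> v w))"
    using A nn C_ge_1 by (intro sum_mono2) (auto intro!: mult_nonneg_nonneg sum_nonneg)
  also have "\<dots> = 2 * C * ((\<Sum>v\<in>A. \<Sum>w\<in>A \<inter> N. (f w)\<^sup>2 * ewt \<Gamma> v w)
      + (\<Sum>v\<in>A. \<Sum>w\<in>A \<inter> N. (f v - f w)\<^sup>2 * ewt \<Gamma> v w))"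
    by (simp add: sum_distrib_left sum.distrib[symmetric] algebra_simps)
  also have "\<dots> \<le> 2 * C * ((\<Sum>v\<in>A \<inter> N. (f v)\<^sup>2 * vwt \<Gamma> v)
      + (\<Sum>v\<in>A. \<Sum>w\<in>A. (f v - f w)\<^sup>2 * ewt \<Gamma> v w))"
  proof (intro mult_left_mono add_mono)
    have "(\<Sum>v\<in>A. \<Sum>w\<in>A \<inter> N. (f w)\<^sup>2 * ewt \<Gamma> v w) = (\<Sum>w\<in>A \<inter> N. \<Sum>v\<in>A. (f w)\<^sup>2 * ewt \<Gamma> v w)"
      by (rule sum.swap)
    also have "\<dots> = (\<Sum>w\<in>A \<inter> N. (f w)\<^sup>2 * (\<Sum>v\<in>A. ewt \<Gamma> w v))"
      using A by (auto simp: sum_distrib_left intro!: sum.cong ewt_sym)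
    also have "\<dots> \<le> (\<Sum>v\<in>A \<inter> N. (f v)\<^sup>2 * vwt \<Gamma> v)"
      using A by (intro sum_mono mult_left_mono ewt_sum_le) auto
    finally show "(\<Sum>v\<in>A. \<Sum>w\<in>A \<inter> N. (f w)\<^sup>2 * ewt \<Gamma> v w) \<le> (\<Sum>v\<in>A \<inter> N. (f v)\<^sup>2 * vwt \<Gamma> v)" .
    show "(\<Sum>v\<in>A. \<Sum>w\<in>A \<inter> N. (f v - f w)\<^sup>2 * ewt \<Gamma> v w)
        \<le> (\<Sum>v\<in>A. \<Sum>w\<in>A. (f v - f w)\<^sup>2 * ewt \<Gamma> v w)"
      using A nn by (intro sum_mono sum_mono2) auto
    show "0 \<le> 2 * C" using C_ge_1 by simp
  qed
  finally show ?thesis .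
qed

text \<open>The shell estimate is iterated outward from \<open>U\<close>. With the energy sum added
  to both sides it becomes a geometric recursion of ratio \<open>1 + 2 * C\<close>: the new layer
  costs \<open>2 * C\<close> times the previous total, and what was already counted costs it once
  more.\<close>

lemma l2_le_near_set:
  fixes f :: "'v \<Rightarrow> real"
  assumes A: "finite A" "A \<subseteq> verts \<Gamma>"
    and closed: "\<And>x y. f x \<noteq> 0 \<Longrightarrow> adj \<Gamma> x y \<Longrightarrow> y \<in> A"
    and near: "\<And>v. v \<in> A \<Longrightarrow> \<exists>u\<in>U. \<exists>j\<le>n. (v, u) \<in> arcs ^^ j"
  shows "(\<Sum>v\<in>A. (f v)\<^sup>2 * vwt \<Gamma> v) \<le> (1 + 2 * C) ^ n *
    ((\<Sum>v\<in>A \<inter> U. (f v)\<^sup>2 * vwt \<Gamma> v) + (\<Sum>v\<in>A. \<Sum>w\<in>A. (f v - f w)\<^sup>2 * ewt \<Gamma> v w))"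
proof -
  define N where "N k = {v. \<exists>u\<in>U. \<exists>j\<le>k. (v, u) \<in> arcs ^^ j}" for k
  define D where "D = (\<Sum>v\<in>A. \<Sum>w\<in>A. (f v - f w)\<^sup>2 * ewt \<Gamma> v w)"
  define S where "S X = (\<Sum>v\<in>A \<inter> X. (f v)\<^sup>2 * vwt \<Gamma> v)" for X
  have D0: "0 \<le> D" unfolding D_def
    using A ewt_nonneg by (intro sum_nonneg mult_nonneg_nonneg) auto
  have step: "S (N (Suc k)) + D \<le> (1 + 2 * C) * (S (N k) + D)" for k
  proof -
    have "\<exists>w\<in>N k. adj \<Gamma> v w" if "v \<in> N (Suc k) - N k" for v
    proof -
      from that obtain u j where u: "u \<in> U" "j \<le> Suc k" "(v, u) \<in> arcs ^^ j"
        unfolding N_def by blast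
      then have j: "j = Suc k" using that unfolding N_def by (auto simp: le_Suc_eq)
      then obtain w where "(v, w) \<in> arcs" "(w, u) \<in> arcs ^^ k"
        using u(3) by (meson relpow_Suc_D2)
      then show ?thesis using u unfolding N_def by auto
    qed
    then have "S (N (Suc k) - N k) \<le> 2 * C * (S (N k) + D)"
      unfolding S_def D_def by (intro l2_shell_le A closed) auto
    moreover have "S (N (Suc k)) = S (N (Suc k) - N k) + S (N k)"
    proof -
      have "N k \<subseteq> N (Suc k)" unfolding N_def using le_SucI by blast
      then have "A \<inter> N (Suc k) = (A \<inter> (N (Suc k) - N k)) \<union> (A \<inter> N k)" by blast
      moreover have "sum g ((A \<inter> (N (Suc k) - N k)) \<union> (A \<inter> N k)) =
          sum g (A \<inter> (N (Suc k) - N k)) + sum g (A \<inter> N k)" for g :: "'v \<Rightarrow> real"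
        using A by (intro sum.union_disjoint) auto
      ultimately show ?thesis unfolding S_def by simp
    qed
    ultimately show ?thesis using D0 by (simp add: algebra_simps)
  qed
  have "S (N k) + D \<le> (1 + 2 * C) ^ k * (S U + D)" for k
  proof (induction k)
    case 0
    have "N 0 = U" unfolding N_def by auto
    then show ?case by simp
  next
    case (Suc k)
    have "S (N (Suc k)) + D \<le> (1 + 2 * C) * (S (N k) + D)" by (rule step)
    also have "\<dots> \<le> (1 + 2 * C) * ((1 + 2 * C) ^ k * (S U + D))"
      using Suc C_ge_1 by (intro mult_left_mono) auto
    finally show ?case by (simp add: mult.assoc)
  qed
  from this[of n] have "S (N n) \<le> (1 + 2 * C) ^ n * (S U + D)" using D0 by linarith
  moreover have "A \<inter> N n = A" using near unfolding N_def by blast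
  ultimately show ?thesis unfolding S_def D_def by simp
qed

end

section \<open>Energies, eigenvalues and minima as finite expressions\<close>

lemma dirichlet_energy_finite:
  fixes f :: "'v \<Rightarrow> real"
  assumes "finite A" "A \<subseteq> verts H"
    and "\<And>x y. x \<in> verts H \<Longrightarrow> y \<in> verts H \<Longrightarrow> x \<notin> A \<or> y \<notin> A \<Longrightarrow> (f x - f y)\<^sup>2 * ewt H x y = 0"
  shows "dirichlet_energy H f = 1/2 * (\<Sum>x\<in>A. \<Sum>y\<in>A. (f x - f y)\<^sup>2 * ewt H x y)"
proof -
  have "(\<Sum>\<^sub>\<infinity>(x, y) \<in> verts H \<times> verts H. \<bar>f x - f y\<bar>\<^sup>2 * ewt H x y)
      = (\<Sum>\<^sub>\<infinity>(x, y) \<in> A \<times> A. (f x - f y)\<^sup>2 * ewt H x y)"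
  proof (rule infsum_cong_neutral)
    fix p assume "p \<in> verts H \<times> verts H - A \<times> A"
    then show "(case p of (x, y) \<Rightarrow> \<bar>f x - f y\<bar>\<^sup>2 * ewt H x y) = 0"
      using assms(3)[of "fst p" "snd p"] by (cases p) (auto simp: power2_abs)
  qed (use assms(2) in \<open>auto simp: power2_abs\<close>)
  also have "\<dots> = (\<Sum>(x, y) \<in> A \<times> A. (f x - f y)\<^sup>2 * ewt H x y)"
    using assms by (intro infsum_finite) auto
  also have "\<dots> = (\<Sum>x\<in>A. \<Sum>y\<in>A. (f x - f y)\<^sup>2 * ewt H x y)"
    by (rule sum.cartesian_product[symmetric])
  finally show ?thesis by (simp add: dirichlet_energy_def)
qed

lemma l2_norm_finite:
  fixes f :: "'v \<Rightarrow> real"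
  assumes "finite A" "A \<subseteq> verts H" "\<And>x. x \<in> verts H - A \<Longrightarrow> f x = 0"
  shows "(\<Sum>\<^sub>\<infinity>x\<in>verts H. \<bar>f x\<bar>\<^sup>2 * vwt H x) = (\<Sum>x\<in>A. (f x)\<^sup>2 * vwt H x)"
proof -
  have "(\<Sum>\<^sub>\<infinity>x\<in>verts H. \<bar>f x\<bar>\<^sup>2 * vwt H x) = (\<Sum>\<^sub>\<infinity>x\<in>A. (f x)\<^sup>2 * vwt H x)"
    using assms by (intro infsum_cong_neutral) (auto simp: power2_abs)
  then show ?thesis using assms by simp
qed

text \<open>On the reals \<open>INF\<close> is a lower bound only for sets bounded below. All
  quotients are nonnegative, also where default values intervene: a non-summable
  \<open>infsum\<close> and a division by zero are both \<open>0\<close>.\<close>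

lemma first_eigenvalue_le:
  assumes "\<And>x y. x \<in> verts H \<Longrightarrow> y \<in> verts H \<Longrightarrow> 0 \<le> ewt H x y"
    and "\<And>x. x \<in> verts H \<Longrightarrow> 0 \<le> vwt H x"
    and "f \<noteq> (\<lambda>_. 0)" "{x. f x \<noteq> 0} \<subseteq> \<Omega>"
  shows "first_eigenvalue H \<Omega> \<le> dirichlet_energy H f / (\<Sum>\<^sub>\<infinity>x\<in>verts H. \<bar>f x\<bar>\<^sup>2 * vwt H x)"
  unfolding first_eigenvalue_def
proof (rule cINF_lower)
  show "bdd_below ((\<lambda>f. dirichlet_energy H f / (\<Sum>\<^sub>\<infinity>x\<in>verts H. \<bar>f x\<bar>\<^sup>2 * vwt H x)) `
      {f. f \<noteq> (\<lambda>_. 0) \<and> {x. f x \<noteq> 0} \<subseteq> \<Omega>})"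
    unfolding dirichlet_energy_def using assms(1,2)
    by (intro bdd_belowI2[where m = 0]) (auto intro!: divide_nonneg_nonneg infsum_nonneg)
qed (use assms in auto)

text \<open>The greatest lower bound property needs some test function; the indicator of a point of
  \<open>\<Omega>\<close> is one.\<close>

lemma first_eigenvalue_ge:
  assumes "\<Omega> \<noteq> {}"
    and "\<And>f. f \<noteq> (\<lambda>_. 0) \<Longrightarrow> {x. f x \<noteq> 0} \<subseteq> \<Omega> \<Longrightarrow>
      m \<le> dirichlet_energy H f / (\<Sum>\<^sub>\<infinity>x\<in>verts H. \<bar>f x\<bar>\<^sup>2 * vwt H x)"
  shows "m \<le> first_eigenvalue H \<Omega>"
  unfolding first_eigenvalue_def
proof (rule cINF_greatest)
  from assms(1) obtain a where "a \<in> \<Omega>" by blast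
  then have "(\<lambda>x. if x = a then 1 else 0) \<in> {f :: 'a \<Rightarrow> real. f \<noteq> (\<lambda>_. 0) \<and> {x. f x \<noteq> 0} \<subseteq> \<Omega>}"
    by (auto simp: fun_eq_iff)
  then show "{f :: 'a \<Rightarrow> real. f \<noteq> (\<lambda>_. 0) \<and> {x. f x \<noteq> 0} \<subseteq> \<Omega>} \<noteq> {}" by blast
qed (use assms in auto)

text \<open>If \<open>A\<close> is empty, both sides are the same value \<open>Min {}\<close>; so
  monotonicity of nested minima requires no separate discussion of empty index sets.\<close>

lemma Min_image_mono:
  fixes g h :: "'a \<Rightarrow> real"
  assumes "finite A" "\<And>a. a \<in> A \<Longrightarrow> g a \<le> h a"
  shows "Min (g ` A) \<le> Min (h ` A)"
proof (cases "A = {}")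
  case False
  then show ?thesis using assms by (auto simp: Min_le_iff intro!: Min.boundedI)
qed simp

section \<open>Graphs decomposed into pages and spine: comparison of energies and norms\<close>

text \<open>What gluing and cutting have in common. Edge weights of a page are bounded only from
  above by those of \<open>\<Gamma>\<close>: after gluing, two page vertices may be joined in
  \<open>\<Gamma>\<close> solely by an edge of the spine or of another page.
  \<open>page_edge\<close> records that such an edge starts at the inner boundary.\<close>

locale page_decomposition = controlled_graph \<Gamma> C for \<Gamma> :: "'v wgraph" and C :: real +
  fixes P :: "nat \<Rightarrow> 'v wgraph" and l :: nat and K :: real
  assumes page_exists: "1 \<le> l"
    and page_verts: "i \<in> {1..l} \<Longrightarrow> verts (P i) \<subseteq> verts \<Gamma>"
    and verts_cover: "verts \<Gamma> \<subseteq> verts (P 0) \<union> (\<Union>i\<in>{1..l}. verts (P i))"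
    and K_ge_1: "1 \<le> K"
    and page_vwt_le: "i \<in> {1..l} \<Longrightarrow> x \<in> verts (P i) \<Longrightarrow> vwt (P i) x \<le> K * vwt \<Gamma> x"
    and vwt_le_page: "i \<in> {1..l} \<Longrightarrow> x \<in> verts (P i) \<Longrightarrow> vwt \<Gamma> x \<le> K * vwt (P i) x"
    and page_ewt_nonneg:
      "i \<in> {1..l} \<Longrightarrow> x \<in> verts (P i) \<Longrightarrow> y \<in> verts (P i) \<Longrightarrow> 0 \<le> ewt (P i) x y"
    and page_ewt_le:
      "i \<in> {1..l} \<Longrightarrow> x \<in> verts (P i) \<Longrightarrow> y \<in> verts (P i) \<Longrightarrow> ewt (P i) x y \<le> K * ewt \<Gamma> x y"
    and page_edge:
      "i \<in> {1..l} \<Longrightarrow> x \<in> verts (P i) \<Longrightarrow> y \<in> verts (P i) \<Longrightarrow> adj \<Gamma> x y \<Longrightarrow>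
        adj (P i) x y \<or> x \<in> inner_boundary \<Gamma> (verts (P i))"
    and boundary_spine: "i \<in> {1..l} \<Longrightarrow> inner_boundary \<Gamma> (verts (P i)) \<subseteq> verts (P 0)"

text \<open>\<open>page_gdist_le\<close> is the form in which uniformity enters: leaving the page
  shortens a path at most by the factor \<open>CU\<close>, the same for all pages.\<close>

locale paged_graph = page_decomposition \<Gamma> C P l K
  for \<Gamma> :: "'v wgraph" and C P l K +
  fixes \<delta> CU :: real and \<Lambda> :: "nat \<Rightarrow> 'v \<Rightarrow> real \<Rightarrow> real \<Rightarrow> real"
  assumes delta_nonneg: "0 \<le> \<delta>"
    and width: "fixed_width l \<Gamma> P \<delta>"
    and CU_pos: "0 < CU"
    and page_gdist_le:
      "i \<in> {1..l} \<Longrightarrow> x \<in> verts (P i) \<Longrightarrow> y \<in> verts (P i) \<Longrightarrow>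
        real (gdist (P i) x y) \<le> CU * real (gdist \<Gamma> x y)"
    and page_FK: "i \<in> {1..l} \<Longrightarrow> relative_FK (P i) (\<Lambda> i)"
begin

abbreviation V :: "nat \<Rightarrow> 'v set" where
  "V i \<equiv> verts (P i)"

lemma page_vwt_pos: "i \<in> {1..l} \<Longrightarrow> x \<in> V i \<Longrightarrow> 0 < vwt (P i) x"
  using vwt_le_page[of i x] vwt_pos[of x] page_verts[of i] K_ge_1
  by (smt (verit) subsetD zero_less_mult_iff)

lemma page_FK_mono:
  "i \<in> {1..l} \<Longrightarrow> z \<in> V i \<Longrightarrow> 0 \<le> r \<Longrightarrow> 0 < \<nu> \<Longrightarrow> \<nu> \<le> \<nu>' \<Longrightarrow> \<Lambda> i z r \<nu>' \<le> \<Lambda> i z r \<nu>"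
  using page_FK unfolding relative_FK_def by blast

lemma page_FK_le:
  assumes "i \<in> {1..l}" "z \<in> V i" "0 \<le> r" "\<Omega> \<noteq> {}" "finite \<Omega>" "\<Omega> \<subseteq> gball (P i) z r"
    and "(\<Sum>x\<in>\<Omega>. vwt (P i) x) \<le> \<nu>"
  shows "\<Lambda> i z r \<nu> \<le> first_eigenvalue (P i) \<Omega>"
proof -
  have sub: "\<Omega> \<subseteq> V i" using assms(6) by (auto simp: gball_def)
  \<comment> \<open>Monotonicity of \<open>\<Lambda> i\<close> in the volume is available only for
    positive volumes.\<close>
  have "0 < (\<Sum>x\<in>\<Omega>. vwt (P i) x)"
    using assms sub page_vwt_pos by (intro sum_pos) auto
  then have "\<Lambda> i z r \<nu> \<le> \<Lambda> i z r (\<Sum>x\<in>\<Omega>. vwt (P i) x)"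
    using assms by (intro page_FK_mono)
  also have "\<dots> = \<Lambda> i z r (vmeasure (P i) \<Omega>)"
    using assms by (simp add: vmeasure_def)
  also have "\<dots> \<le> first_eigenvalue (P i) \<Omega>"
    using page_FK[OF assms(1)] assms unfolding relative_FK_def by blast
  finally show ?thesis .
qed

text \<open>For \<open>f\<close> supported in \<open>\<Omega>\<close>, every pair with a nonzero
  energy term lies in this set: an edge with one end in \<open>\<Omega>\<close> has both ends here.
  Energies and norms thus become finite sums over one index set, intersected with the page where
  needed.\<close>

definition star :: "'v set \<Rightarrow> 'v set" where
  "star \<Omega> = \<Omega> \<union> (\<Union>x\<in>\<Omega>. nbrs \<Gamma> x)"

lemma star:
  assumes "finite \<Omega>" "\<Omega> \<subseteq> verts \<Gamma>"
  shows "finite (star \<Omega>)" "star \<Omega> \<subseteq> verts \<Gamma>" "\<Omega> \<subseteq> star \<Omega>"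
    "x \<in> \<Omega> \<Longrightarrow> adj \<Gamma> x y \<Longrightarrow> y \<in> star \<Omega>"
proof -
  show "finite (star \<Omega>)" using assms finite_nbrs by (auto simp: star_def)
qed (use assms adj_verts in \<open>auto simp: star_def nbrs_def\<close>)

lemma energy_term_zero:
  fixes f :: "'v \<Rightarrow> real"
  assumes "finite \<Omega>" "\<Omega> \<subseteq> verts \<Gamma>" "{x. f x \<noteq> 0} \<subseteq> \<Omega>"
    and "x \<in> verts \<Gamma>" "y \<in> verts \<Gamma>" "x \<notin> star \<Omega> \<or> y \<notin> star \<Omega>"
  shows "f x = f y \<or> ewt \<Gamma> x y = 0"
proof (cases "adj \<Gamma> x y")
  case True
  then have "adj \<Gamma> y x" using adj_commute by blast
  then have "x \<notin> \<Omega>" "y \<notin> \<Omega>" using star[OF assms(1,2)] True assms(6) by blast+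
  then have "f x = 0" "f y = 0" using assms(3) by auto
  then show ?thesis by simp
qed (use ewt_nonadj assms in auto)

lemma energy_eq:
  assumes "finite \<Omega>" "\<Omega> \<subseteq> verts \<Gamma>" "{x. f x \<noteq> 0} \<subseteq> \<Omega>"
  shows "dirichlet_energy \<Gamma> f =
    1/2 * (\<Sum>x\<in>star \<Omega>. \<Sum>y\<in>star \<Omega>. (f x - f y)\<^sup>2 * ewt \<Gamma> x y)"
  using assms energy_term_zero[OF assms]
  by (intro dirichlet_energy_finite star) auto

lemma page_energy_eq:
  assumes i: "i \<in> {1..l}" and "finite \<Omega>" "\<Omega> \<subseteq> verts \<Gamma>" "{x. f x \<noteq> 0} \<subseteq> \<Omega>"
  shows "dirichlet_energy (P i) f =
    1/2 * (\<Sum>x\<in>star \<Omega> \<inter> V i. \<Sum>y\<in>star \<Omega> \<inter> V i. (f x - f y)\<^sup>2 * ewt (P i) x y)"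
proof (rule dirichlet_energy_finite)
  fix x y assume xy: "x \<in> V i" "y \<in> V i" "x \<notin> star \<Omega> \<inter> V i \<or> y \<notin> star \<Omega> \<inter> V i"
  then have "f x = f y \<or> ewt \<Gamma> x y = 0"
    using energy_term_zero[OF assms(2-4), of x y] page_verts[OF i] by auto
  then show "(f x - f y)\<^sup>2 * ewt (P i) x y = 0"
    using page_ewt_nonneg[OF i xy(1,2)] page_ewt_le[OF i xy(1,2)] by auto
qed (use star[OF assms(2,3)] in auto)

text \<open>Test functions for the page must vanish outside it, hence the truncation. It creates no
  energy, because the energy of the page sums only over pairs inside the page, where the truncated
  function agrees with \<open>f\<close>.\<close>

lemma page_energy_le:
  fixes f :: "'v \<Rightarrow> real"
  assumes i: "i \<in> {1..l}" and \<Omega>: "finite \<Omega>" "\<Omega> \<subseteq> verts \<Gamma>" "{x. f x \<noteq> 0} \<subseteq> \<Omega>"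
  shows "dirichlet_energy (P i) (\<lambda>x. if x \<in> V i then f x else 0) \<le> K * dirichlet_energy \<Gamma> f"
proof -
  let ?g = "\<lambda>x. if x \<in> V i then f x else 0"
  let ?A = "star \<Omega>"
  have "{x. ?g x \<noteq> 0} \<subseteq> \<Omega>" using \<Omega> by auto
  then have "dirichlet_energy (P i) ?g
      = 1/2 * (\<Sum>x\<in>?A \<inter> V i. \<Sum>y\<in>?A \<inter> V i. (?g x - ?g y)\<^sup>2 * ewt (P i) x y)"
    by (rule page_energy_eq[OF i \<Omega>(1,2)])
  also have "\<dots> \<le> 1/2 * (\<Sum>x\<in>?A \<inter> V i. \<Sum>y\<in>?A \<inter> V i. (f x - f y)\<^sup>2 * (K * ewt \<Gamma> x y))"
    using page_ewt_le[OF i] by (intro mult_left_mono sum_mono mult_mono) (auto simp: page_ewt_nonneg[OF i])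
  also have "\<dots> \<le> 1/2 * (\<Sum>x\<in>?A. \<Sum>y\<in>?A. (f x - f y)\<^sup>2 * (K * ewt \<Gamma> x y))"
  proof (rule mult_left_mono)
    have nn: "0 \<le> (f x - f y)\<^sup>2 * (K * ewt \<Gamma> x y)" if "x \<in> ?A" "y \<in> ?A" for x y
      using that star(2)[OF \<Omega>(1,2)] ewt_nonneg[of x y] K_ge_1 by (intro mult_nonneg_nonneg) auto
    show "(\<Sum>x\<in>?A \<inter> V i. \<Sum>y\<in>?A \<inter> V i. (f x - f y)\<^sup>2 * (K * ewt \<Gamma> x y))
        \<le> (\<Sum>x\<in>?A. \<Sum>y\<in>?A. (f x - f y)\<^sup>2 * (K * ewt \<Gamma> x y))"
    proof (rule order_trans)
      show "(\<Sum>x\<in>?A \<inter> V i. \<Sum>y\<in>?A \<inter> V i. (f x - f y)\<^sup>2 * (K * ewt \<Gamma> x y))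
          \<le> (\<Sum>x\<in>?A \<inter> V i. \<Sum>y\<in>?A. (f x - f y)\<^sup>2 * (K * ewt \<Gamma> x y))"
        using star(1)[OF \<Omega>(1,2)] nn by (intro sum_mono sum_mono2) auto
      show "\<dots> \<le> (\<Sum>x\<in>?A. \<Sum>y\<in>?A. (f x - f y)\<^sup>2 * (K * ewt \<Gamma> x y))"
        using star(1)[OF \<Omega>(1,2)] nn by (intro sum_mono2 sum_nonneg) auto
    qed
  qed auto
  also have "\<dots> = K * dirichlet_energy \<Gamma> f"
    unfolding energy_eq[OF \<Omega>] by (simp add: sum_distrib_left mult.left_commute)
  finally show ?thesis .
qed

text \<open>The Rayleigh quotient with its denominator cleared, so that \<open>f\<close> vanishing
  on the page is covered as well: then the left side is \<open>0\<close> whatever \<open>m\<close>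
  is. If \<open>\<Omega>\<close> has no vertex in the page, this is the only case.\<close>

lemma page_l2_eigenvalue_le:
  fixes f :: "'v \<Rightarrow> real"
  assumes i: "i \<in> {1..l}" and \<Omega>: "finite \<Omega>" "\<Omega> \<subseteq> verts \<Gamma>" "{x. f x \<noteq> 0} \<subseteq> \<Omega>"
    and m: "\<Omega> \<inter> V i \<noteq> {} \<Longrightarrow> m \<le> first_eigenvalue (P i) (\<Omega> \<inter> V i)"
  shows "m * (\<Sum>x\<in>star \<Omega> \<inter> V i. (f x)\<^sup>2 * vwt (P i) x) \<le> K * dirichlet_energy \<Gamma> f"
proof -
  let ?g = "\<lambda>x. if x \<in> V i then f x else 0"
  let ?A = "star \<Omega> \<inter> V i"
  have A: "finite ?A" using star[OF \<Omega>(1,2)] by auto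
  have n: "(\<Sum>\<^sub>\<infinity>x\<in>V i. \<bar>?g x\<bar>\<^sup>2 * vwt (P i) x) = (\<Sum>x\<in>?A. (?g x)\<^sup>2 * vwt (P i) x)"
    using A star(3)[OF \<Omega>(1,2)] \<Omega>(3) by (intro l2_norm_finite) auto
  have eq: "(\<Sum>x\<in>?A. (?g x)\<^sup>2 * vwt (P i) x) = (\<Sum>x\<in>?A. (f x)\<^sup>2 * vwt (P i) x)"
    by (intro sum.cong) auto
  have E: "dirichlet_energy (P i) ?g \<le> K * dirichlet_energy \<Gamma> f"
    by (rule page_energy_le[OF i \<Omega>])
  show ?thesis
  proof (cases "\<forall>x\<in>V i. f x = 0")
    case True
    have "dirichlet_energy (P i) ?g \<ge> 0"
      unfolding dirichlet_energy_def
      by (intro mult_nonneg_nonneg infsum_nonneg) (auto intro!: mult_nonneg_nonneg page_ewt_nonneg[OF i])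
    moreover have "(\<Sum>x\<in>?A. (f x)\<^sup>2 * vwt (P i) x) = 0" using True by (intro sum.neutral) auto
    ultimately show ?thesis using E by simp
  next
    case False
    then obtain a where a: "a \<in> V i" "f a \<noteq> 0" by blast
    then have aO: "a \<in> \<Omega> \<inter> V i" using \<Omega> by auto
    then have aA: "a \<in> ?A" using star(3)[OF \<Omega>(1,2)] by auto
    have pos: "0 < (\<Sum>x\<in>?A. (f x)\<^sup>2 * vwt (P i) x)"
      using a aA A page_vwt_pos[OF i] less_imp_le[OF page_vwt_pos[OF i]]
      by (intro sum_pos2[of _ a]) auto
    have "m \<le> first_eigenvalue (P i) (\<Omega> \<inter> V i)" using m aO by blast
    also have "\<dots> \<le> dirichlet_energy (P i) ?g / (\<Sum>\<^sub>\<infinity>x\<in>V i. \<bar>?g x\<bar>\<^sup>2 * vwt (P i) x)"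
    proof (rule first_eigenvalue_le)
      show "?g \<noteq> (\<lambda>_. 0)" using a by (metis (no_types, lifting))
    qed (use page_ewt_nonneg[OF i] page_vwt_pos[OF i] \<Omega>(3) in \<open>auto intro: less_imp_le\<close>)
    finally have "m * (\<Sum>x\<in>?A. (f x)\<^sup>2 * vwt (P i) x) \<le> dirichlet_energy (P i) ?g"
      unfolding n eq using pos by (simp add: pos_le_divide_eq)
    then show ?thesis using E by linarith
  qed
qed

text \<open>The test function is the indicator of \<open>a\<close>; its energy in
  \<open>\<Gamma>\<close> is at most the sum of the edge weights at \<open>a\<close>, hence at most
  \<open>vwt \<Gamma> a\<close>. One factor \<open>K\<close> comes from the page energy, the other
  from returning to \<open>vwt (P i) a\<close>.\<close>

lemma page_eigenvalue_bounded:
  assumes i: "i \<in> {1..l}" and a: "a \<in> \<Omega>" "a \<in> V i"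
  shows "first_eigenvalue (P i) \<Omega> \<le> K\<^sup>2"
proof -
  let ?f = "\<lambda>x. if x = a then 1 else 0 :: real"
  have aG: "a \<in> verts \<Gamma>" using page_verts i a by blast
  let ?A = "star {a}"
  have A: "finite ?A" "?A \<subseteq> verts \<Gamma>" "a \<in> ?A" using star[of "{a}"] aG by auto
  have "first_eigenvalue (P i) \<Omega> \<le> dirichlet_energy (P i) ?f / (\<Sum>\<^sub>\<infinity>x\<in>V i. \<bar>?f x\<bar>\<^sup>2 * vwt (P i) x)"
    by (rule first_eigenvalue_le)
      (use page_ewt_nonneg[OF i] page_vwt_pos[OF i] a in \<open>auto intro: less_imp_le simp: fun_eq_iff\<close>)
  also have "(\<Sum>\<^sub>\<infinity>x\<in>V i. \<bar>?f x\<bar>\<^sup>2 * vwt (P i) x) = vwt (P i) a"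
    by (subst l2_norm_finite[of "{a}"]) (use a in auto)
  also have "dirichlet_energy (P i) ?f \<le> K\<^sup>2 * vwt (P i) a"
  proof -
    have "?f = (\<lambda>x. if x \<in> V i then ?f x else 0)" using a by auto
    then have "dirichlet_energy (P i) ?f \<le> K * dirichlet_energy \<Gamma> ?f"
      using page_energy_le[OF i, of "{a}" ?f] aG by auto
    also have "dirichlet_energy \<Gamma> ?f
        = 1/2 * (\<Sum>x\<in>?A. \<Sum>y\<in>?A. (?f x - ?f y)\<^sup>2 * ewt \<Gamma> x y)"
      using aG by (intro energy_eq) auto
    \<comment> \<open>Only pairs containing \<open>a\<close> contribute, and each edge at
      \<open>a\<close> occurs in both orders, which cancels the factor \<open>1/2\<close>.\<close>
    also have "\<dots> \<le> 1/2 * (\<Sum>x\<in>?A. \<Sum>y\<in>?A. (if x = a then ewt \<Gamma> a y else 0) + (if y = a then ewt \<Gamma> a x else 0))"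
      using A ewt_nonneg ewt_sym by (intro mult_left_mono sum_mono) (auto simp: subset_iff)
    also have "\<dots> = (\<Sum>y\<in>?A. ewt \<Gamma> a y)"
    proof -
      have "(\<Sum>x\<in>?A. \<Sum>y\<in>?A. if x = a then ewt \<Gamma> a y else 0) = (\<Sum>y\<in>?A. ewt \<Gamma> a y)"
        by (subst sum.swap) (use A in simp)
      then show ?thesis using A by (simp add: sum.distrib)
    qed
    also have "\<dots> \<le> vwt \<Gamma> a" using A aG by (intro ewt_sum_le) auto
    also have "\<dots> \<le> K * vwt (P i) a" using vwt_le_page i a by blast
    finally show ?thesis using K_ge_1 by (simp add: power2_eq_square mult_left_mono mult.assoc)
  qed
  finally show ?thesis using page_vwt_pos[OF i a(2)]
    by (simp add: divide_right_mono)
qed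

lemma near_page:
  assumes "v \<in> verts \<Gamma>"
  shows "\<exists>i\<in>{1..l}. v \<in> nbhd \<Gamma> (V i) \<delta>"
proof (cases "v \<in> V 0")
  case True
  then show ?thesis using width unfolding fixed_width_def by blast
next
  case False
  then obtain i where "i \<in> {1..l}" "v \<in> V i" using verts_cover assms by blast
  then show ?thesis using assms delta_nonneg by (auto simp: nbhd_def intro!: bexI[of _ i] bexI[of _ v])
qed

text \<open>This is \<open>l2_le_near_set\<close> for the union of the pages; distances are
  integers, so \<delta> becomes \<open>nat \<lfloor>\<delta>\<rfloor>\<close> steps. A vertex shared
  by several pages is counted once for each, which only enlarges the right side. The factor
  \<open>2\<close> undoes the \<open>1/2\<close> in the energy.\<close>

lemma l2_le_pages:
  fixes f :: "'v \<Rightarrow> real"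
  assumes \<Omega>: "finite \<Omega>" "\<Omega> \<subseteq> verts \<Gamma>" "{x. f x \<noteq> 0} \<subseteq> \<Omega>"
  shows "(\<Sum>x\<in>star \<Omega>. (f x)\<^sup>2 * vwt \<Gamma> x) \<le> (1 + 2 * C) ^ nat \<lfloor>\<delta>\<rfloor> *
    (K * (\<Sum>i\<in>{1..l}. \<Sum>x\<in>star \<Omega> \<inter> V i. (f x)\<^sup>2 * vwt (P i) x) + 2 * dirichlet_energy \<Gamma> f)"
proof -
  let ?A = "star \<Omega>" and ?U = "\<Union>i\<in>{1..l}. V i"
  have A: "finite ?A" "?A \<subseteq> verts \<Gamma>" using star[OF \<Omega>(1,2)] by auto
  have near: "\<exists>u\<in>?U. \<exists>j\<le>nat \<lfloor>\<delta>\<rfloor>. (v, u) \<in> arcs ^^ j" if "v \<in> ?A" for v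
  proof -
    have "v \<in> verts \<Gamma>" using that A by blast
    then obtain i u where u: "i \<in> {1..l}" "u \<in> V i" "real (gdist \<Gamma> v u) \<le> \<delta>"
      using near_page[of v] unfolding nbhd_def by blast
    then have "(v, u) \<in> arcs ^^ gdist \<Gamma> v u" "gdist \<Gamma> v u \<le> nat \<lfloor>\<delta>\<rfloor>"
      using gdist_walk[of v u] that A page_verts by (auto simp: le_nat_floor)
    then show ?thesis using u by blast
  qed
  have "(\<Sum>x\<in>?A. (f x)\<^sup>2 * vwt \<Gamma> x) \<le> (1 + 2 * C) ^ nat \<lfloor>\<delta>\<rfloor> *
    ((\<Sum>x\<in>?A \<inter> ?U. (f x)\<^sup>2 * vwt \<Gamma> x) + (\<Sum>x\<in>?A. \<Sum>y\<in>?A. (f x - f y)\<^sup>2 * ewt \<Gamma> x y))"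
    by (rule l2_le_near_set[OF A _ near]) (use star(4)[OF \<Omega>(1,2)] \<Omega>(3) in auto)
  also have "\<dots> \<le> (1 + 2 * C) ^ nat \<lfloor>\<delta>\<rfloor> *
    (K * (\<Sum>i\<in>{1..l}. \<Sum>x\<in>?A \<inter> V i. (f x)\<^sup>2 * vwt (P i) x) + 2 * dirichlet_energy \<Gamma> f)"
  proof (intro mult_left_mono add_mono)
    have "(\<Sum>x\<in>?A \<inter> ?U. (f x)\<^sup>2 * vwt \<Gamma> x) \<le> (\<Sum>i\<in>{1..l}. \<Sum>x\<in>?A \<inter> V i. (f x)\<^sup>2 * vwt \<Gamma> x)"
    proof -
      let ?g = "\<lambda>x. (f x)\<^sup>2 * vwt \<Gamma> x"
      have nn: "0 \<le> ?g x" if "x \<in> ?A" for x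
        using A vwt_pos[of x] that by auto
      have "?g x \<le> (\<Sum>i\<in>{1..l}. if x \<in> V i then ?g x else 0)" if x: "x \<in> ?A \<inter> ?U" for x
      proof -
        from x obtain i where i: "i \<in> {1..l}" "x \<in> V i" by blast
        then have "?g x = (if x \<in> V i then ?g x else 0)" by simp
        also have "\<dots> \<le> (\<Sum>i\<in>{1..l}. if x \<in> V i then ?g x else 0)"
          using i nn x by (intro member_le_sum) auto
        finally show ?thesis .
      qed
      then have "(\<Sum>x\<in>?A \<inter> ?U. ?g x)
          \<le> (\<Sum>x\<in>?A \<inter> ?U. \<Sum>i\<in>{1..l}. if x \<in> V i then ?g x else 0)"
        by (rule sum_mono)
      also have "\<dots> \<le> (\<Sum>x\<in>?A. \<Sum>i\<in>{1..l}. if x \<in> V i then ?g x else 0)"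
        using A nn by (intro sum_mono2) (auto intro!: sum_nonneg)
      also have "\<dots> = (\<Sum>i\<in>{1..l}. \<Sum>x\<in>?A \<inter> V i. ?g x)"
        by (subst sum.swap) (simp add: sum.inter_restrict[OF A(1)])
      finally show ?thesis .
    qed
    also have "\<dots> \<le> (\<Sum>i\<in>{1..l}. \<Sum>x\<in>?A \<inter> V i. (f x)\<^sup>2 * (K * vwt (P i) x))"
      using vwt_le_page by (intro sum_mono mult_left_mono) auto
    finally show "(\<Sum>x\<in>?A \<inter> ?U. (f x)\<^sup>2 * vwt \<Gamma> x) \<le> K * (\<Sum>i\<in>{1..l}. \<Sum>x\<in>?A \<inter> V i. (f x)\<^sup>2 * vwt (P i) x)"
      by (simp add: sum_distrib_left mult.left_commute)
    show "(\<Sum>x\<in>?A. \<Sum>y\<in>?A. (f x - f y)\<^sup>2 * ewt \<Gamma> x y) \<le> 2 * dirichlet_energy \<Gamma> f"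
      by (simp add: energy_eq[OF \<Omega>])
    show "0 \<le> (1 + 2 * C) ^ nat \<lfloor>\<delta>\<rfloor>" using C_ge_1 by simp
  qed
  finally show ?thesis .
qed

lemma energy_nonneg: "0 \<le> dirichlet_energy \<Gamma> f"
  unfolding dirichlet_energy_def
  by (intro mult_nonneg_nonneg infsum_nonneg) (auto intro!: mult_nonneg_nonneg ewt_nonneg)

lemma eigenvalue_geI:
  assumes \<Omega>: "finite \<Omega>" "\<Omega> \<subseteq> verts \<Gamma>" "\<Omega> \<noteq> {}"
    and c: "\<And>f. {x. f x \<noteq> 0} \<subseteq> \<Omega> \<Longrightarrow>
      c * (\<Sum>x\<in>star \<Omega>. (f x)\<^sup>2 * vwt \<Gamma> x) \<le> dirichlet_energy \<Gamma> f"
  shows "c \<le> first_eigenvalue \<Gamma> \<Omega>"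
proof (rule first_eigenvalue_ge[OF \<Omega>(3)])
  fix f :: "'v \<Rightarrow> real"
  assume f: "f \<noteq> (\<lambda>_. 0)" "{x. f x \<noteq> 0} \<subseteq> \<Omega>"
  have eq: "(\<Sum>\<^sub>\<infinity>x\<in>verts \<Gamma>. \<bar>f x\<bar>\<^sup>2 * vwt \<Gamma> x) = (\<Sum>x\<in>star \<Omega>. (f x)\<^sup>2 * vwt \<Gamma> x)"
    using star[OF \<Omega>(1,2)] f(2) by (intro l2_norm_finite) auto
  from f(1) obtain a where a: "f a \<noteq> 0" by blast
  then have "a \<in> star \<Omega>" using f(2) star(3)[OF \<Omega>(1,2)] by blast
  moreover have "0 < vwt \<Gamma> x" if "x \<in> star \<Omega>" for x
    using that star(2)[OF \<Omega>(1,2)] vwt_pos by blast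
  ultimately have "0 < (\<Sum>x\<in>star \<Omega>. (f x)\<^sup>2 * vwt \<Gamma> x)"
    using a star(1)[OF \<Omega>(1,2)] by (intro sum_pos2[of _ a]) (auto simp: less_imp_le)
  then show "c \<le> dirichlet_energy \<Gamma> f / (\<Sum>\<^sub>\<infinity>x\<in>verts \<Gamma>. \<bar>f x\<bar>\<^sup>2 * vwt \<Gamma> x)"
    unfolding eq using c[OF f(2)] by (simp add: pos_le_divide_eq)
qed

section \<open>Balls contained in a page\<close>

lemma geodesic:
  assumes "x \<in> verts \<Gamma>" "y \<in> verts \<Gamma>"
  obtains p where "p 0 = x" "p (gdist \<Gamma> x y) = y"
    "\<And>j. j < gdist \<Gamma> x y \<Longrightarrow> adj \<Gamma> (p j) (p (Suc j))"
    "\<And>j. j \<le> gdist \<Gamma> x y \<Longrightarrow> p j \<in> verts \<Gamma> \<and> gdist \<Gamma> x (p j) \<le> j"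
proof -
  obtain p where p: "p 0 = x" "p (gdist \<Gamma> x y) = y"
    "\<And>j. j < gdist \<Gamma> x y \<Longrightarrow> adj \<Gamma> (p j) (p (Suc j))"
    using gdist_walk[OF assms] unfolding relpow_fun_conv by auto
  have "p j \<in> verts \<Gamma> \<and> gdist \<Gamma> x (p j) \<le> j" if "j \<le> gdist \<Gamma> x y" for j
    using that
  proof (induction j)
    case 0
    then show ?case using p(1) assms by simp
  next
    case (Suc j)
    then show ?case
      using p(3)[of j] adj_verts gdist_adj[OF assms(1), of "p j" "p (Suc j)"] by fastforce
  qed
  then show ?thesis using that p by blast
qed

text \<open>An edge of \<open>\<Gamma>\<close> between two vertices of a page that is not an edge of the page starts at
  the inner boundary; a geodesic within a ball contained in the page cannot use it, as its nearer
  end point would have a neighbour outside the page but inside the ball.\<close>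

lemma gball_subset_page_gball:
  assumes i: "i \<in> {1..l}" and z: "z \<in> verts \<Gamma>" and sub: "gball \<Gamma> z r \<subseteq> V i"
  shows "gball \<Gamma> z r \<subseteq> gball (P i) z r"
proof
  fix y assume y: "y \<in> gball \<Gamma> z r"
  then have yv: "y \<in> verts \<Gamma>" and yr: "real (gdist \<Gamma> z y) \<le> r" by (auto simp: gball_def)
  obtain p where p: "p 0 = z" "p (gdist \<Gamma> z y) = y"
    "\<And>j. j < gdist \<Gamma> z y \<Longrightarrow> adj \<Gamma> (p j) (p (Suc j))"
    "\<And>j. j \<le> gdist \<Gamma> z y \<Longrightarrow> p j \<in> verts \<Gamma> \<and> gdist \<Gamma> z (p j) \<le> j"
    using geodesic[OF z yv] by blast
  have pV: "p j \<in> V i" if "j \<le> gdist \<Gamma> z y" for j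
    using p(4)[OF that] that yr sub by (auto simp: gball_def)
  have "adj (P i) (p j) (p (Suc j))" if j: "j < gdist \<Gamma> z y" for j
  proof (rule ccontr)
    assume "\<not> adj (P i) (p j) (p (Suc j))"
    then have "p j \<in> inner_boundary \<Gamma> (V i)"
      using page_edge[OF i pV pV p(3), of j] j by auto
    then obtain w where w: "w \<in> verts \<Gamma> - V i" "adj \<Gamma> w (p j)"
      unfolding inner_boundary_def by blast
    then have "gdist \<Gamma> z w \<le> gdist \<Gamma> z (p j) + 1"
      using gdist_adj[OF z, of "p j" w] adj_commute by blast
    then have "gdist \<Gamma> z w \<le> gdist \<Gamma> z y" using p(4)[of j] j by simp
    then have "w \<in> gball \<Gamma> z r" using w yr by (auto simp: gball_def)
    then show False using w sub by blast
  qed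
  then have "path_in (P i) (V i) (gdist \<Gamma> z y) p"
    using pV by (auto simp: path_in_def)
  then have "gdist (P i) z y \<le> gdist \<Gamma> z y"
    unfolding gdist_def[of "P i"] using p by (intro cInf_lower) auto
  then show "y \<in> gball (P i) z r" using y sub yr by (auto simp: gball_def)
qed

text \<open>All of \<open>\<Omega>\<close> lies in one page, so its two eigenvalues can be compared
  directly: one factor \<open>K\<close> is lost in the energy and one in the norm. The
  \<open>K\<close> in the volume bounds the measure of the page by that of
  \<open>\<Gamma>\<close>.\<close>

lemma FK_ball_in_page:
  assumes i: "i \<in> {1..l}" and z: "z \<in> verts \<Gamma>" and r: "0 \<le> r" and sub: "gball \<Gamma> z r \<subseteq> V i"
    and \<Omega>: "\<Omega> \<noteq> {}" "\<Omega> \<subseteq> gball \<Gamma> z r"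
  shows "1 / K\<^sup>2 * \<Lambda> i z r (K * vmeasure \<Gamma> \<Omega>) \<le> first_eigenvalue \<Gamma> \<Omega>"
proof -
  define m where "m = \<Lambda> i z r (K * vmeasure \<Gamma> \<Omega>)"
  have fin: "finite \<Omega>" using \<Omega> finite_gball[OF z] finite_subset by blast
  have \<Omega>V: "\<Omega> \<subseteq> V i" "\<Omega> \<subseteq> verts \<Gamma>" using \<Omega> sub page_verts[OF i] by blast+
  have zV: "z \<in> V i" using z r sub by (auto simp: gball_def)
  have "(\<Sum>x\<in>\<Omega>. vwt (P i) x) \<le> (\<Sum>x\<in>\<Omega>. K * vwt \<Gamma> x)"
    using \<Omega>V page_vwt_le[OF i] by (intro sum_mono) auto
  also have "\<dots> = K * vmeasure \<Gamma> \<Omega>" using fin by (simp add: vmeasure_def sum_distrib_left)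
  finally have m: "m \<le> first_eigenvalue (P i) \<Omega>"
    unfolding m_def using gball_subset_page_gball[OF i z sub] \<Omega> fin zV r
    by (intro page_FK_le[OF i]) auto
  have "1 / K\<^sup>2 * m \<le> first_eigenvalue \<Gamma> \<Omega>"
  proof (rule eigenvalue_geI[OF fin \<Omega>V(2) \<Omega>(1)])
    fix f :: "'v \<Rightarrow> real" assume f: "{x. f x \<noteq> 0} \<subseteq> \<Omega>"
    let ?n = "\<Sum>x\<in>star \<Omega>. (f x)\<^sup>2 * vwt \<Gamma> x"
    let ?ni = "\<Sum>x\<in>star \<Omega> \<inter> V i. (f x)\<^sup>2 * vwt (P i) x"
    have "?n = (\<Sum>x\<in>star \<Omega> \<inter> V i. (f x)\<^sup>2 * vwt \<Gamma> x)"
      using f \<Omega>V star(1)[OF fin \<Omega>V(2)] by (intro sum.mono_neutral_right) auto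
    also have "\<dots> \<le> (\<Sum>x\<in>star \<Omega> \<inter> V i. (f x)\<^sup>2 * (K * vwt (P i) x))"
      using vwt_le_page[OF i] by (intro sum_mono mult_left_mono) auto
    also have "\<dots> = K * ?ni" by (simp add: sum_distrib_left mult.left_commute)
    finally have n: "?n \<le> K * ?ni" .
    have "0 \<le> ?n"
      using star(2)[OF fin \<Omega>V(2)] vwt_pos
      by (intro sum_nonneg mult_nonneg_nonneg) (auto simp: less_imp_le subset_iff)
    have "\<Omega> \<inter> V i = \<Omega>" using \<Omega>V by blast
    then have ni: "m * ?ni \<le> K * dirichlet_energy \<Gamma> f"
      using m by (intro page_l2_eigenvalue_le[OF i fin \<Omega>V(2) f]) simp
    have "m * ?n \<le> K\<^sup>2 * dirichlet_energy \<Gamma> f"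
    \<comment> \<open>For negative \<open>m\<close> the norm comparison would point the wrong way,
      but then the left side is at most \<open>0\<close> and the energy is nonnegative.\<close>
    proof (cases "0 \<le> m")
      case True
      then have "m * ?n \<le> m * (K * ?ni)" using n by (intro mult_left_mono)
      also have "\<dots> = K * (m * ?ni)" by simp
      also have "\<dots> \<le> K * (K * dirichlet_energy \<Gamma> f)" using ni K_ge_1 by (intro mult_left_mono) auto
      finally show ?thesis by (simp add: power2_eq_square mult.assoc)
    next
      case False
      then have "m * ?n \<le> 0" using \<open>0 \<le> ?n\<close> by (simp add: mult_nonpos_nonneg)
      also have "0 \<le> K\<^sup>2 * dirichlet_energy \<Gamma> f" using energy_nonneg by simp
      finally show ?thesis .
    qed
    then show "1 / K\<^sup>2 * m * ?n \<le> dirichlet_energy \<Gamma> f"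
      using K_ge_1 by (simp add: pos_divide_le_eq mult.commute)
  qed
  then show ?thesis by (simp add: m_def)
qed

section \<open>Balls not contained in any page\<close>

text \<open>Geodesics from the centre stay in the ball. One that ends on the other side of the page
  than \<open>z\<close> has a step between the page and its complement, and the page end of that
  step is on the inner boundary: the earlier vertex if \<open>z\<close> is in the page, the later
  one otherwise.\<close>

lemma boundary_point:
  assumes z: "z \<in> verts \<Gamma>" and meet: "gball \<Gamma> z r \<inter> V i \<noteq> {}" and out: "\<not> gball \<Gamma> z r \<subseteq> V i"
  shows "\<exists>\<alpha>\<in>gball \<Gamma> z r. \<alpha> \<in> inner_boundary \<Gamma> (V i)"
proof -
  have cross: "\<exists>j<k. Q j \<and> \<not> Q (Suc j)" if "Q 0" "\<not> Q k" for Q and k :: nat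
    using that by (induction k) (auto intro: less_SucI)
  have ball: "\<exists>p k. p 0 = z \<and> p k = y \<and> (\<forall>j<k. adj \<Gamma> (p j) (p (Suc j))) \<and> (\<forall>j\<le>k. p j \<in> gball \<Gamma> z r)"
    if y: "y \<in> gball \<Gamma> z r" for y
  proof -
    have yv: "y \<in> verts \<Gamma>" "real (gdist \<Gamma> z y) \<le> r" using y by (auto simp: gball_def)
    obtain p where p: "p 0 = z" "p (gdist \<Gamma> z y) = y"
      "\<And>j. j < gdist \<Gamma> z y \<Longrightarrow> adj \<Gamma> (p j) (p (Suc j))"
      "\<And>j. j \<le> gdist \<Gamma> z y \<Longrightarrow> p j \<in> verts \<Gamma> \<and> gdist \<Gamma> z (p j) \<le> j"
      using geodesic[OF z yv(1)] by blast
    have "p j \<in> gball \<Gamma> z r" if "j \<le> gdist \<Gamma> z y" for j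
      using p(4)[OF that] that yv by (auto simp: gball_def)
    then show ?thesis using p by blast
  qed
  show ?thesis
  proof (cases "z \<in> V i")
    case True
    from out obtain y where y: "y \<in> gball \<Gamma> z r" "y \<notin> V i" by blast
    then obtain p k where p: "p 0 = z" "p k = y" "\<And>j. j < k \<Longrightarrow> adj \<Gamma> (p j) (p (Suc j))"
      "\<And>j. j \<le> k \<Longrightarrow> p j \<in> gball \<Gamma> z r" using ball by blast
    obtain j where j: "j < k" "p j \<in> V i" "p (Suc j) \<notin> V i"
      using cross[of "\<lambda>j. p j \<in> V i" k] p True y by auto
    then have "p j \<in> inner_boundary \<Gamma> (V i)"
      using p(3)[of j] adj_verts adj_commute unfolding inner_boundary_def by blast
    then show ?thesis using p(4)[of j] j by auto
  next
    case False
    from meet obtain y where y: "y \<in> gball \<Gamma> z r" "y \<in> V i" by blast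
    then obtain p k where p: "p 0 = z" "p k = y" "\<And>j. j < k \<Longrightarrow> adj \<Gamma> (p j) (p (Suc j))"
      "\<And>j. j \<le> k \<Longrightarrow> p j \<in> gball \<Gamma> z r" using ball by blast
    obtain j where j: "j < k" "p j \<notin> V i" "p (Suc j) \<in> V i"
      using cross[of "\<lambda>j. p j \<notin> V i" k] p False y by auto
    then have "p (Suc j) \<in> inner_boundary \<Gamma> (V i)"
      using p(3)[of j] adj_verts unfolding inner_boundary_def by blast
    then show ?thesis using p(4)[of "Suc j"] j by auto
  qed
qed

abbreviation near_spine :: "'v \<Rightarrow> real \<Rightarrow> nat \<Rightarrow> 'v set" where
  "near_spine z r i \<equiv> nbhd \<Gamma> (gball \<Gamma> z r) \<delta> \<inter> V i \<inter> nbhd \<Gamma> (V 0) \<delta>"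

lemma finite_near_spine: "z \<in> verts \<Gamma> \<Longrightarrow> finite (near_spine z r i)"
  using finite_nbhd[OF finite_gball] by (auto simp: gball_def)

lemma finite_page_indices: "finite (page_indices l \<Gamma> P \<delta> B)"
  by (simp add: page_indices_def)

lemma augmented_page_spine: "v \<in> V 0 \<Longrightarrow> v \<in> nbhd \<Gamma> (V i) \<delta> \<Longrightarrow> v \<in> augmented_page \<Gamma> P \<delta> i"
  by (simp add: augmented_page_def)

lemma page_subset_augmented: "i \<in> {1..l} \<Longrightarrow> V i \<subseteq> augmented_page \<Gamma> P \<delta> i"
proof
  fix x assume x: "i \<in> {1..l}" "x \<in> V i"
  then have "x \<in> verts \<Gamma>" using page_verts by blast
  then show "x \<in> augmented_page \<Gamma> P \<delta> i"
    using x delta_nonneg by (auto simp: augmented_page_def nbhd_def intro!: bexI[of _ x])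
qed

text \<open>\<open>Lambda_bar\<close> without its leading factor, so that estimates can be stated
  before \<open>c\<^sub>1\<close> is fixed.\<close>

definition Lmin :: "real \<Rightarrow> real \<Rightarrow> 'v \<Rightarrow> real \<Rightarrow> real \<Rightarrow> real" where
  "Lmin c\<^sub>2 c\<^sub>3 z r \<nu> = (MIN i \<in> page_indices l \<Gamma> P \<delta> (gball \<Gamma> z r).
      MIN \<alpha> \<in> near_spine z r i. \<Lambda> i \<alpha> (c\<^sub>2 * r) (c\<^sub>3 * \<nu>))"

lemma Lmin_le:
  assumes "z \<in> verts \<Gamma>" "i \<in> page_indices l \<Gamma> P \<delta> (gball \<Gamma> z r)" "\<alpha> \<in> near_spine z r i"
  shows "Lmin c\<^sub>2 c\<^sub>3 z r \<nu> \<le> \<Lambda> i \<alpha> (c\<^sub>2 * r) (c\<^sub>3 * \<nu>)"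
proof -
  have "Lmin c\<^sub>2 c\<^sub>3 z r \<nu> \<le> (MIN \<alpha> \<in> near_spine z r i. \<Lambda> i \<alpha> (c\<^sub>2 * r) (c\<^sub>3 * \<nu>))"
    unfolding Lmin_def using assms finite_page_indices by (intro Min_le) auto
  also have "\<dots> \<le> \<Lambda> i \<alpha> (c\<^sub>2 * r) (c\<^sub>3 * \<nu>)"
    using assms finite_near_spine[OF assms(1), of r i] by (intro Min_le finite_imageI imageI)
  finally show ?thesis .
qed

lemma Lmin_antimono:
  assumes "z \<in> verts \<Gamma>" "0 \<le> c\<^sub>2 * r" "0 < c\<^sub>3" "0 < \<nu>" "\<nu> \<le> \<nu>'"
  shows "Lmin c\<^sub>2 c\<^sub>3 z r \<nu>' \<le> Lmin c\<^sub>2 c\<^sub>3 z r \<nu>"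
  unfolding Lmin_def
proof (intro Min_image_mono finite_page_indices finite_near_spine assms(1) page_FK_mono)
qed (use assms in \<open>auto simp: page_indices_def\<close>)

text \<open>The boundary vertex is a legitimate centre for the inner minimum. Going through
  \<open>z\<close> it is within \<open>2 * r\<close> of every point of \<open>\<Omega>\<close>, and
  \<open>CU\<close> converts this to the distance of the page. \<open>c\<^sub>3\<close> stays free
  above \<open>K\<close>, since \<open>Lmin_bounded\<close> will dictate a larger value.\<close>

lemma Lmin_le_page_eigenvalue:
  assumes z: "z \<in> verts \<Gamma>" and r: "0 \<le> r"
    and out: "\<not> (\<exists>i\<in>{1..l}. gball \<Gamma> z r \<subseteq> V i)"
    and \<Omega>: "\<Omega> \<subseteq> gball \<Gamma> z r" and i: "i \<in> {1..l}" and ne: "\<Omega> \<inter> V i \<noteq> {}" and c3: "K \<le> c\<^sub>3"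
  shows "Lmin (2 * CU) c\<^sub>3 z r (vmeasure \<Gamma> \<Omega>) \<le> first_eigenvalue (P i) (\<Omega> \<inter> V i)"
proof -
  obtain \<alpha> where \<alpha>: "\<alpha> \<in> gball \<Gamma> z r" "\<alpha> \<in> inner_boundary \<Gamma> (V i)"
  proof -
    have "gball \<Gamma> z r \<inter> V i \<noteq> {}" using \<Omega> ne by blast
    moreover have "\<not> gball \<Gamma> z r \<subseteq> V i" using out i by blast
    ultimately show ?thesis using boundary_point[OF z] that by blast
  qed
  have \<alpha>V: "\<alpha> \<in> V i" "\<alpha> \<in> V 0" "\<alpha> \<in> verts \<Gamma>"
    using \<alpha> boundary_spine[OF i] by (auto simp: inner_boundary_def gball_def)
  have fin: "finite \<Omega>" and \<Omega>v: "\<Omega> \<subseteq> verts \<Gamma>"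
    using \<Omega> finite_gball[OF z] finite_subset by (auto simp: gball_def)
  have "i \<in> page_indices l \<Gamma> P \<delta> (gball \<Gamma> z r)"
    using i ne \<Omega> page_subset_augmented[OF i] by (auto simp: page_indices_def)
  moreover have "\<alpha> \<in> near_spine z r i"
    using \<alpha> \<alpha>V delta_nonneg by (auto simp: nbhd_def intro!: bexI[of _ \<alpha>])
  ultimately have "Lmin (2 * CU) c\<^sub>3 z r (vmeasure \<Gamma> \<Omega>)
      \<le> \<Lambda> i \<alpha> (2 * CU * r) (c\<^sub>3 * vmeasure \<Gamma> \<Omega>)"
    using Lmin_le[OF z] by blast
  also have "\<dots> \<le> first_eigenvalue (P i) (\<Omega> \<inter> V i)"
  proof (rule page_FK_le[OF i \<alpha>V(1)])
    show "0 \<le> 2 * CU * r" using CU_pos r by simp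
    show "\<Omega> \<inter> V i \<subseteq> gball (P i) \<alpha> (2 * CU * r)"
    proof
      fix x assume x: "x \<in> \<Omega> \<inter> V i"
      then have xv: "x \<in> verts \<Gamma>" using \<Omega>v by blast
      have "gdist \<Gamma> \<alpha> x \<le> gdist \<Gamma> \<alpha> z + gdist \<Gamma> z x"
        by (rule gdist_triangle[OF \<alpha>V(3) z xv])
      also have "gdist \<Gamma> \<alpha> z = gdist \<Gamma> z \<alpha>" by (rule gdist_commute[OF \<alpha>V(3) z])
      finally have "real (gdist \<Gamma> \<alpha> x) \<le> real (gdist \<Gamma> z \<alpha>) + real (gdist \<Gamma> z x)" by simp
      also have "\<dots> \<le> 2 * r" using \<alpha>(1) x \<Omega> by (auto simp: gball_def subset_iff)
      finally have "CU * real (gdist \<Gamma> \<alpha> x) \<le> CU * (2 * r)"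
        using CU_pos by (intro mult_left_mono) auto
      then have "real (gdist (P i) \<alpha> x) \<le> 2 * CU * r"
        using page_gdist_le[OF i \<alpha>V(1), of x] x by simp
      then show "x \<in> gball (P i) \<alpha> (2 * CU * r)" using x by (simp add: gball_def)
    qed
    have "(\<Sum>x\<in>\<Omega> \<inter> V i. vwt (P i) x) \<le> (\<Sum>x\<in>\<Omega> \<inter> V i. c\<^sub>3 * vwt \<Gamma> x)"
    proof (rule sum_mono)
      fix x assume x: "x \<in> \<Omega> \<inter> V i"
      then have "vwt (P i) x \<le> K * vwt \<Gamma> x" using page_vwt_le[OF i] by blast
      also have "\<dots> \<le> c\<^sub>3 * vwt \<Gamma> x" using c3 vwt_pos[of x] x \<Omega>v by (intro mult_right_mono) auto
      finally show "vwt (P i) x \<le> c\<^sub>3 * vwt \<Gamma> x" .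
    qed
    also have "\<dots> \<le> (\<Sum>x\<in>\<Omega>. c\<^sub>3 * vwt \<Gamma> x)"
      using fin \<Omega>v vwt_pos c3 K_ge_1 by (intro sum_mono2) (auto intro!: mult_nonneg_nonneg less_imp_le)
    also have "\<dots> = c\<^sub>3 * vmeasure \<Gamma> \<Omega>" using fin by (simp add: vmeasure_def sum_distrib_left)
    finally show "(\<Sum>x\<in>\<Omega> \<inter> V i. vwt (P i) x) \<le> c\<^sub>3 * vmeasure \<Gamma> \<Omega>" .
  qed (use ne fin in auto)
  finally show ?thesis .
qed

text \<open>Absorbs the energy term of \<open>l2_le_pages\<close> once that inequality is multiplied
  by \<open>Lmin\<close>. If the chosen \<open>w\<close> lies in a page, the eigenvalue of
  \<open>\<Omega>\<close> in that page is the intermediate bound; otherwise it is the eigenvalue of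
  a single page vertex near \<open>w\<close>.\<close>

lemma Lmin_bounded:
  assumes z: "z \<in> verts \<Gamma>" and r: "0 \<le> r"
    and out: "\<not> (\<exists>i\<in>{1..l}. gball \<Gamma> z r \<subseteq> V i)"
    and \<Omega>: "\<Omega> \<subseteq> gball \<Gamma> z r" "\<Omega> \<noteq> {}"
  shows "Lmin (2 * CU) (K * C ^ nat \<lfloor>\<delta>\<rfloor>) z r (vmeasure \<Gamma> \<Omega>) \<le> K\<^sup>2"
proof -
  let ?c = "K * C ^ nat \<lfloor>\<delta>\<rfloor>"
  have c: "K \<le> ?c" using K_ge_1 C_ge_1 by simp
  from \<Omega> obtain w where w: "w \<in> \<Omega>" by blast
  then have wB: "w \<in> gball \<Gamma> z r" and wv: "w \<in> verts \<Gamma>" using \<Omega> by (auto simp: gball_def)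
  show ?thesis
  proof (cases "\<exists>i\<in>{1..l}. w \<in> V i")
    case True
    then obtain i where i: "i \<in> {1..l}" "w \<in> V i" by blast
    then have "\<Omega> \<inter> V i \<noteq> {}" using w by blast
    then have "Lmin (2 * CU) ?c z r (vmeasure \<Gamma> \<Omega>) \<le> first_eigenvalue (P i) (\<Omega> \<inter> V i)"
      using Lmin_le_page_eigenvalue[OF z r out \<Omega>(1) i(1) _ c] by blast
    also have "\<dots> \<le> K\<^sup>2" using page_eigenvalue_bounded[OF i(1)] w i(2) by blast
    finally show ?thesis .
  next
    case False
    then have w0: "w \<in> V 0" using verts_cover wv by blast
    obtain i where i: "i \<in> {1..l}" "w \<in> nbhd \<Gamma> (V i) \<delta>" using near_page[OF wv] by blast
    then obtain \<alpha> where \<alpha>: "\<alpha> \<in> V i" "real (gdist \<Gamma> w \<alpha>) \<le> \<delta>" unfolding nbhd_def by blast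
    have \<alpha>v: "\<alpha> \<in> verts \<Gamma>" using \<alpha> page_verts[OF i(1)] by blast
    have d: "gdist \<Gamma> \<alpha> w \<le> nat \<lfloor>\<delta>\<rfloor>" "real (gdist \<Gamma> \<alpha> w) \<le> \<delta>"
      using \<alpha> gdist_commute[OF \<alpha>v wv] by (auto simp: le_nat_floor)
    have "i \<in> page_indices l \<Gamma> P \<delta> (gball \<Gamma> z r)"
      using i wB augmented_page_spine[OF w0] by (auto simp: page_indices_def)
    \<comment> \<open>\<open>w\<close> lies in the ball and in the spine, so it witnesses both
      \<delta>-neighbourhoods for \<open>\<alpha>\<close>, which need not lie in the ball
      itself.\<close>
    moreover have "\<alpha> \<in> near_spine z r i"
      using \<alpha> \<alpha>v d wB w0 by (auto simp: nbhd_def intro!: bexI[of _ w])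
    ultimately have "Lmin (2 * CU) ?c z r (vmeasure \<Gamma> \<Omega>)
        \<le> \<Lambda> i \<alpha> (2 * CU * r) (?c * vmeasure \<Gamma> \<Omega>)"
      using Lmin_le[OF z] by blast
    \<comment> \<open>Since \<open>\<alpha>\<close> may lie outside \<open>\<Omega>\<close>, its
      weight is compared with that of \<open>w\<close> along at most
      \<open>nat \<lfloor>\<delta>\<rfloor>\<close> edges, each costing a factor \<open>C\<close>.
      This is the source of the power of \<open>C\<close> in the volume factor.\<close>
    also have "\<dots> \<le> first_eigenvalue (P i) {\<alpha>}"
    proof (rule page_FK_le[OF i(1) \<alpha>(1)])
      show nn: "0 \<le> 2 * CU * r" using CU_pos r by simp
      have "real (gdist (P i) \<alpha> \<alpha>) \<le> CU * real (gdist \<Gamma> \<alpha> \<alpha>)"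
        using page_gdist_le[OF i(1)] \<alpha> by blast
      then show "{\<alpha>} \<subseteq> gball (P i) \<alpha> (2 * CU * r)" using \<alpha> \<alpha>v nn by (auto simp: gball_def)
      have "vwt (P i) \<alpha> \<le> K * vwt \<Gamma> \<alpha>" using page_vwt_le i \<alpha> by blast
      also have "vwt \<Gamma> \<alpha> \<le> C ^ gdist \<Gamma> \<alpha> w * vwt \<Gamma> w"
        by (rule vwt_walk_le[OF gdist_walk[OF \<alpha>v wv]])
      also have "\<dots> \<le> C ^ nat \<lfloor>\<delta>\<rfloor> * vwt \<Gamma> w"
        using d C_ge_1 vwt_pos[OF wv] by (intro mult_right_mono power_increasing) auto
      also have "vwt \<Gamma> w \<le> vmeasure \<Gamma> \<Omega>"
      proof -
        have fin: "finite \<Omega>" using \<Omega> finite_gball[OF z] finite_subset by blast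
        have "vwt \<Gamma> w \<le> (\<Sum>x\<in>\<Omega>. vwt \<Gamma> x)"
          using w fin \<Omega> vwt_pos by (intro member_le_sum) (auto simp: gball_def less_imp_le subset_iff)
        then show ?thesis using fin by (simp add: vmeasure_def)
      qed
      finally show "(\<Sum>x\<in>{\<alpha>}. vwt (P i) x) \<le> ?c * vmeasure \<Gamma> \<Omega>"
        using K_ge_1 C_ge_1 by (simp add: mult.assoc)
    qed auto
    also have "\<dots> \<le> K\<^sup>2" using page_eigenvalue_bounded[OF i(1)] \<alpha> by blast
    finally show ?thesis .
  qed
qed

text \<open>In the denominator, \<open>(1 + 2 * C) ^ nat \<lfloor>\<delta>\<rfloor>\<close> is the
  cost of reaching all vertices from the pages, \<open>K\<^sup>2 * real l\<close> collects the
  inequalities of the \<open>l\<close> pages, and \<open>K\<^sup>2 * 2\<close> is the energy term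
  absorbed through \<open>Lmin_bounded\<close>.\<close>

lemma FK_ball_not_in_page:
  assumes z: "z \<in> verts \<Gamma>" and r: "0 \<le> r"
    and out: "\<not> (\<exists>i\<in>{1..l}. gball \<Gamma> z r \<subseteq> V i)"
    and \<Omega>: "\<Omega> \<subseteq> gball \<Gamma> z r" "\<Omega> \<noteq> {}"
  shows "1 / ((1 + 2 * C) ^ nat \<lfloor>\<delta>\<rfloor> * (K\<^sup>2 * (real l + 2))) *
    Lmin (2 * CU) (K * C ^ nat \<lfloor>\<delta>\<rfloor>) z r (vmeasure \<Gamma> \<Omega>) \<le> first_eigenvalue \<Gamma> \<Omega>"
    (is "1 / ?D * ?M \<le> _")
proof (rule eigenvalue_geI)
  show fin: "finite \<Omega>" and \<Omega>v: "\<Omega> \<subseteq> verts \<Gamma>"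
    using \<Omega> finite_gball[OF z] finite_subset by (auto simp: gball_def)
  fix f :: "'v \<Rightarrow> real" assume f: "{x. f x \<noteq> 0} \<subseteq> \<Omega>"
  let ?n = "\<Sum>x\<in>star \<Omega>. (f x)\<^sup>2 * vwt \<Gamma> x" and ?E = "dirichlet_energy \<Gamma> f"
  let ?ni = "\<lambda>i. \<Sum>x\<in>star \<Omega> \<inter> V i. (f x)\<^sup>2 * vwt (P i) x"
  let ?L = "(1 + 2 * C) ^ nat \<lfloor>\<delta>\<rfloor>"
  have L: "0 < ?L" using C_ge_1 by simp
  have D: "0 < ?D" using L K_ge_1 by (intro mult_pos_pos) auto
  have n0: "0 \<le> ?n"
    using star(2)[OF fin \<Omega>v] vwt_pos
      by (intro sum_nonneg mult_nonneg_nonneg) (auto simp: less_imp_le subset_iff)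
  have "?M * ?n \<le> ?D * ?E"
  \<comment> \<open>A negative minimum makes the inequality trivial, as for balls inside a
    page.\<close>
  proof (cases "0 \<le> ?M")
    case True
    have c: "K \<le> K * C ^ nat \<lfloor>\<delta>\<rfloor>" using K_ge_1 C_ge_1 by simp
    have "?M * ?ni i \<le> K * ?E" if i: "i \<in> {1..l}" for i
      by (rule page_l2_eigenvalue_le[OF i fin \<Omega>v f])
        (use Lmin_le_page_eigenvalue[OF z r out \<Omega>(1) i _ c] in blast)
    then have "(\<Sum>i\<in>{1..l}. ?M * ?ni i) \<le> (\<Sum>i\<in>{1..l}. K * ?E)" by (rule sum_mono)
    then have s: "K * (?M * (\<Sum>i\<in>{1..l}. ?ni i)) \<le> K * (real l * (K * ?E))"
      using K_ge_1 by (intro mult_left_mono) (auto simp: sum_distrib_left)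
    have "?M * ?n \<le> ?M * (?L * (K * (\<Sum>i\<in>{1..l}. ?ni i) + 2 * ?E))"
      using l2_le_pages[OF fin \<Omega>v f] True by (intro mult_left_mono)
    also have "\<dots> = ?L * (K * (?M * (\<Sum>i\<in>{1..l}. ?ni i)) + ?M * (2 * ?E))"
      by (simp add: algebra_simps)
    also have "\<dots> \<le> ?L * (K * (real l * (K * ?E)) + K\<^sup>2 * (2 * ?E))"
    proof (rule mult_left_mono[OF add_mono[OF s]])
      show "?M * (2 * ?E) \<le> K\<^sup>2 * (2 * ?E)"
        using Lmin_bounded[OF z r out \<Omega>] energy_nonneg[of f] by (intro mult_right_mono) auto
    qed (use L in simp)
    also have "\<dots> = ?D * ?E" by (simp add: power2_eq_square algebra_simps)
    finally show ?thesis .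
  next
    case False
    then have "?M * ?n \<le> 0" using n0 by (simp add: mult_nonpos_nonneg)
    also have "0 \<le> ?D * ?E" using D energy_nonneg[of f] by simp
    finally show ?thesis .
  qed
  then have "?M * ?n / ?D \<le> ?E" using D by (simp only: pos_divide_le_eq mult.commute[of ?D])
  then show "1 / ?D * ?M * ?n \<le> ?E" by simp
qed (rule \<Omega>(2))

text \<open>The constants do not involve \<open>\<sigma>\<close>, so one choice of them serves every
  selection of pages.\<close>

theorem relative_FK_paged:
  assumes \<sigma>: "page_choice l \<Gamma> P \<sigma>"
  shows "relative_FK \<Gamma> (\<lambda>z r \<nu>.
      if \<exists>i\<in>{1..l}. gball \<Gamma> z r \<subseteq> V i
      then 1 / K\<^sup>2 * \<Lambda> (\<sigma> z r) z r (K * \<nu>)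
      else Lambda_bar l \<Gamma> P \<delta> \<Lambda> (1 / ((1 + 2 * C) ^ nat \<lfloor>\<delta>\<rfloor> * (K\<^sup>2 * (real l + 2))))
        (2 * CU) (K * C ^ nat \<lfloor>\<delta>\<rfloor>) z r \<nu>)"
proof -
  let ?D = "(1 + 2 * C) ^ nat \<lfloor>\<delta>\<rfloor> * (K\<^sup>2 * (real l + 2))" and ?c = "K * C ^ nat \<lfloor>\<delta>\<rfloor>"
  have D: "0 < 1 / ?D" using C_ge_1 K_ge_1 by (intro divide_pos_pos mult_pos_pos) auto
  have c: "0 < ?c" using C_ge_1 K_ge_1 by simp
  have bar: "Lambda_bar l \<Gamma> P \<delta> \<Lambda> (1 / ?D) (2 * CU) ?c z r \<nu> = 1 / ?D * Lmin (2 * CU) ?c z r \<nu>" for z r \<nu>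
    by (simp add: Lambda_bar_def Lmin_def)
  have "infinite (V 1)" using page_FK[of 1] page_exists by (simp add: relative_FK_def)
  then have inf: "infinite (verts \<Gamma>)" using page_verts[of 1] page_exists finite_subset by auto
  show ?thesis
    unfolding relative_FK_def bar
  proof (intro conjI ballI allI impI inf)
    fix z :: 'v and r \<nu> \<nu>' :: real
    assume z: "z \<in> verts \<Gamma>" and r: "0 \<le> r" and \<nu>: "0 < \<nu> \<and> \<nu> \<le> \<nu>'"
    show "(if \<exists>i\<in>{1..l}. gball \<Gamma> z r \<subseteq> V i then 1 / K\<^sup>2 * \<Lambda> (\<sigma> z r) z r (K * \<nu>')
        else 1 / ?D * Lmin (2 * CU) ?c z r \<nu>')
      \<le> (if \<exists>i\<in>{1..l}. gball \<Gamma> z r \<subseteq> V i then 1 / K\<^sup>2 * \<Lambda> (\<sigma> z r) z r (K * \<nu>)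
        else 1 / ?D * Lmin (2 * CU) ?c z r \<nu>)"
    proof (cases "\<exists>i\<in>{1..l}. gball \<Gamma> z r \<subseteq> V i")
      case True
      then have i: "\<sigma> z r \<in> {1..l}" "gball \<Gamma> z r \<subseteq> V (\<sigma> z r)"
        using \<sigma> unfolding page_choice_def by blast+
      then have "z \<in> V (\<sigma> z r)" using z r by (auto simp: gball_def)
      then have "\<Lambda> (\<sigma> z r) z r (K * \<nu>') \<le> \<Lambda> (\<sigma> z r) z r (K * \<nu>)"
        using \<nu> K_ge_1 by (intro page_FK_mono i(1) r mult_left_mono) auto
      then have "1 / K\<^sup>2 * \<Lambda> (\<sigma> z r) z r (K * \<nu>') \<le> 1 / K\<^sup>2 * \<Lambda> (\<sigma> z r) z r (K * \<nu>)"
        by (intro mult_left_mono) auto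
      then show ?thesis using True by (simp only: if_True)
    next
      case False
      have "Lmin (2 * CU) ?c z r \<nu>' \<le> Lmin (2 * CU) ?c z r \<nu>"
        using c \<nu> CU_pos r by (intro Lmin_antimono z) auto
      then have "1 / ?D * Lmin (2 * CU) ?c z r \<nu>' \<le> 1 / ?D * Lmin (2 * CU) ?c z r \<nu>"
        using D by (intro mult_left_mono) auto
      then show ?thesis using False by (simp only: if_False)
    qed
  next
    fix z :: 'v and r :: real and \<Omega>
    assume z: "z \<in> verts \<Gamma>" and r: "0 \<le> r" and \<Omega>: "\<Omega> \<noteq> {} \<and> \<Omega> \<subseteq> gball \<Gamma> z r"
    show "(if \<exists>i\<in>{1..l}. gball \<Gamma> z r \<subseteq> V i
        then 1 / K\<^sup>2 * \<Lambda> (\<sigma> z r) z r (K * vmeasure \<Gamma> \<Omega>)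
        else 1 / ?D * Lmin (2 * CU) ?c z r (vmeasure \<Gamma> \<Omega>)) \<le> first_eigenvalue \<Gamma> \<Omega>"
    proof (cases "\<exists>i\<in>{1..l}. gball \<Gamma> z r \<subseteq> V i")
      case True
      then have i: "\<sigma> z r \<in> {1..l}" "gball \<Gamma> z r \<subseteq> V (\<sigma> z r)"
        using \<sigma> unfolding page_choice_def by blast+
      have "1 / K\<^sup>2 * \<Lambda> (\<sigma> z r) z r (K * vmeasure \<Gamma> \<Omega>) \<le> first_eigenvalue \<Gamma> \<Omega>"
        using \<Omega> by (intro FK_ball_in_page[OF i(1) z r i(2)]) auto
      then show ?thesis using True by (simp only: if_True)
    next
      case False
      have "1 / ?D * Lmin (2 * CU) ?c z r (vmeasure \<Gamma> \<Omega>) \<le> first_eigenvalue \<Gamma> \<Omega>"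
        using \<Omega> by (intro FK_ball_not_in_page[OF z r False]) auto
      then show ?thesis using False by (simp only: if_False)
    qed
  qed
qed

end

section \<open>Controlled weights: derivation from admissibility and transport along
  isomorphisms\<close>

text \<open>Positivity of the vertex weights is not required, so that spines are included.\<close>

definition controlled_weights :: "'v wgraph \<Rightarrow> real \<Rightarrow> bool" where
  "controlled_weights H C \<longleftrightarrow>
     simple_graph H \<and> adapted H \<and> (\<forall>x\<in>verts H. 0 \<le> vwt H x) \<and>
     (\<forall>x\<in>verts H. \<forall>S. finite S \<and> S \<subseteq> verts H \<longrightarrow> (\<Sum>y\<in>S. ewt H x y) \<le> vwt H x) \<and>
     (\<forall>x y. adj H x y \<longrightarrow> vwt H x \<le> C * ewt H x y)"

lemma simple_graph_adjD:
  assumes "simple_graph H" "adj H x y"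
  shows "x \<in> verts H \<and> y \<in> verts H"
proof -
  obtain a b where "a \<in> verts H" "b \<in> verts H" "{x, y} = {a, b}"
    using assms unfolding simple_graph_def adj_def by blast
  then show ?thesis by (auto simp: doubleton_eq_iff)
qed

text \<open>Each edge weight at \<open>x\<close> is positive and at most \<open>vwt H x\<close>, so
  weight zero can occur only at isolated vertices.\<close>

lemma controlled_weights_vwt_pos:
  assumes "controlled_weights H C" "adj H x y"
  shows "0 < vwt H x"
proof -
  have xy: "x \<in> verts H" "y \<in> verts H"
    using assms simple_graph_adjD unfolding controlled_weights_def by metis+
  then have "0 < ewt H x y"
    using assms unfolding controlled_weights_def adapted_def by (metis less_eq_real_def)
  also have "\<dots> = (\<Sum>y\<in>{y}. ewt H x y)" by simp
  also have "\<dots> \<le> vwt H x" using assms xy unfolding controlled_weights_def by blast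
  finally show ?thesis .
qed

lemma controlled_weights_mono:
  assumes "controlled_weights H C" "C \<le> C'"
  shows "controlled_weights H C'"
proof -
  have "vwt H x \<le> C' * ewt H x y" if "adj H x y" for x y
  proof -
    have "x \<in> verts H" "y \<in> verts H"
      using assms that simple_graph_adjD unfolding controlled_weights_def by metis+
    then have "0 \<le> ewt H x y" using assms unfolding controlled_weights_def adapted_def by blast
    then have "C * ewt H x y \<le> C' * ewt H x y" using assms(2) by (rule mult_right_mono[rotated])
    then show ?thesis using assms(1) that unfolding controlled_weights_def by fastforce
  qed
  then show ?thesis using assms unfolding controlled_weights_def by blast
qed

text \<open>The infinite sum over neighbours is traded for finite partial sums, and the quotient for
  a product that makes sense also at spine vertices of weight zero.\<close>

lemma admissible_weights_controlled:
  assumes simple: "simple_graph H" and adm: "admissible_weights H"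
    and nonneg: "\<And>x. x \<in> verts H \<Longrightarrow> 0 \<le> vwt H x"
  shows "\<exists>C\<ge>1. controlled_weights H C"
proof -
  have ad: "adapted H" using adm by (simp add: admissible_weights_def)
  have sum: "(\<Sum>y\<in>S. ewt H x y) \<le> vwt H x"
    if x: "x \<in> verts H" and S: "finite S" "S \<subseteq> verts H" for x S
  proof -
    have sub: "ewt H x summable_on nbrs H x" "(\<Sum>\<^sub>\<infinity>y\<in>nbrs H x. ewt H x y) \<le> vwt H x"
      using adm x unfolding admissible_weights_def subordinate_def by blast+
    have "(\<Sum>y\<in>S. ewt H x y) = (\<Sum>y\<in>S \<inter> nbrs H x. ewt H x y)"
      using ad x S by (intro sum.mono_neutral_right) (auto simp: adapted_def nbrs_def)
    also have "\<dots> \<le> (\<Sum>\<^sub>\<infinity>y\<in>nbrs H x. ewt H x y)"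
      using ad x S by (intro finite_sum_le_infsum sub(1)) (auto simp: adapted_def nbrs_def)
    finally show ?thesis using sub by linarith
  qed
  obtain Cc where Cc: "Cc > 1" "\<And>x y. x \<in> verts H \<Longrightarrow> y \<in> nbrs H x \<Longrightarrow> ewt H x y / vwt H x \<ge> 1 / Cc"
    using adm unfolding admissible_weights_def controlled_def by blast
  have "vwt H x \<le> Cc * ewt H x y" if xy: "adj H x y" for x y
  proof (cases "vwt H x = 0")
    case True
    have "x \<in> verts H" "y \<in> verts H" using simple_graph_adjD[OF simple xy] by auto
    then have "0 \<le> ewt H x y" using ad by (simp add: adapted_def)
    then show ?thesis using True Cc(1) by simp
  next
    case False
    have v: "x \<in> verts H" "y \<in> verts H" using simple_graph_adjD[OF simple xy] by auto
    then have "0 < vwt H x" using nonneg[of x] False by simp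
    moreover have "ewt H x y / vwt H x \<ge> 1 / Cc" using Cc(2)[of x y] v xy by (simp add: nbrs_def)
    ultimately show ?thesis using Cc(1) by (simp add: field_simps)
  qed
  then have "controlled_weights H Cc"
    using simple ad nonneg sum unfolding controlled_weights_def by blast
  then show ?thesis using Cc(1) by (intro exI[of _ Cc]) auto
qed

lemma controlled_weights_iso:
  assumes iso: "wgraph_iso h Q H" and Q: "controlled_weights Q C"
  shows "controlled_weights H C"
proof -
  have bij: "bij_betw h (verts Q) (verts H)" and E: "edges H = (\<lambda>e. h ` e) ` edges Q"
    and vw: "\<And>x. x \<in> verts Q \<Longrightarrow> vwt H (h x) = vwt Q x"
    and ew: "\<And>x y. x \<in> verts Q \<Longrightarrow> y \<in> verts Q \<Longrightarrow> ewt H (h x) (h y) = ewt Q x y"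
    using iso unfolding wgraph_iso_def by blast+
  have inj: "inj_on h (verts Q)" and im: "verts H = h ` verts Q"
    using bij by (auto simp: bij_betw_def)
  have simple: "simple_graph Q" and ad: "adapted Q" using Q by (auto simp: controlled_weights_def)
  have sub: "e \<subseteq> verts Q" if "e \<in> edges Q" for e
    using simple that unfolding simple_graph_def by fastforce
  have adj: "adj H (h x) (h y) \<longleftrightarrow> adj Q x y" if "x \<in> verts Q" "y \<in> verts Q" for x y
  proof
    assume "adj H (h x) (h y)"
    then obtain e where e: "e \<in> edges Q" "h ` {x, y} = h ` e" unfolding adj_def E by auto
    then have "{x, y} = e" using inj_on_image_eq_iff[OF inj, of "{x, y}" e] sub that by blast
    then show "adj Q x y" using e by (simp add: adj_def)
  next
    assume "adj Q x y"
    then have "h ` {x, y} \<in> edges H" unfolding adj_def E by (rule imageI)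
    then show "adj H (h x) (h y)" by (simp add: adj_def)
  qed
  have simpleH: "simple_graph H"
    unfolding simple_graph_def
  proof
    fix e assume "e \<in> edges H"
    then obtain e' where e': "e' \<in> edges Q" "e = h ` e'" unfolding E by blast
    then obtain x y where xy: "x \<in> verts Q" "y \<in> verts Q" "x \<noteq> y" "e' = {x, y}"
      using simple unfolding simple_graph_def by blast
    then have "h x \<noteq> h y" "h x \<in> verts H" "h y \<in> verts H" "e = {h x, h y}"
      using inj_onD[OF inj, of x y] im e' by auto
    then show "\<exists>x\<in>verts H. \<exists>y\<in>verts H. x \<noteq> y \<and> e = {x, y}" by blast
  qed
  have "adapted H"
    using ad adj ew unfolding adapted_def im ball_simps(9) by metis
  moreover have "\<forall>x\<in>verts H. 0 \<le> vwt H x"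
    using Q vw unfolding controlled_weights_def im by simp
  moreover have "(\<Sum>y\<in>S. ewt H x y) \<le> vwt H x" if x: "x \<in> verts H" and S: "finite S" "S \<subseteq> verts H" for x S
  proof -
    obtain a where a: "a \<in> verts Q" "x = h a" using x im by blast
    obtain T where T: "T \<subseteq> verts Q" "S = h ` T" using S(2) unfolding im by (elim subset_imageE) (rule that)
    have injT: "inj_on h T" using inj T inj_on_subset by blast
    have "(\<Sum>y\<in>S. ewt H x y) = (\<Sum>b\<in>T. ewt Q a b)"
      unfolding T(2) sum.reindex[OF injT] using a T ew by (intro sum.cong) auto
    also have "\<dots> \<le> vwt Q a"
      using Q a T S finite_imageD[OF _ injT] unfolding controlled_weights_def by blast
    finally show ?thesis using a vw by simp
  qed
  moreover have "vwt H x \<le> C * ewt H x y" if "adj H x y" for x y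
  proof -
    have "x \<in> h ` verts Q" "y \<in> h ` verts Q"
      using simple_graph_adjD[OF simpleH that] im by auto
    then obtain a b where "a \<in> verts Q" "b \<in> verts Q" "x = h a" "y = h b" by blast
    then show ?thesis using that adj vw ew Q unfolding controlled_weights_def by simp
  qed
  ultimately show ?thesis using simpleH unfolding controlled_weights_def by blast
qed

lemma controlled_graphI:
  assumes "controlled_weights \<Gamma> C" "1 \<le> C" "connected_in \<Gamma> (verts \<Gamma>)"
    and "\<And>x. x \<in> verts \<Gamma> \<Longrightarrow> 0 < vwt \<Gamma> x"
  shows "controlled_graph \<Gamma> C"
proof
  show "x \<in> verts \<Gamma> \<and> y \<in> verts \<Gamma>" if "adj \<Gamma> x y" for x y
    using simple_graph_adjD[OF _ that] assms(1) by (simp add: controlled_weights_def)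
qed (use assms in \<open>auto simp: controlled_weights_def adapted_def\<close>)

section \<open>Gluing\<close>

text \<open>Where a piece has positive weight at \<open>x\<close>, each of the at most
  \<open>l + 1\<close> contributions to \<open>vwt \<Gamma> x\<close> is at most \<open>R\<close>
  times that weight. Every edge of \<open>\<Gamma>\<close> lies in some piece, whose weight at its
  ends is positive and controlled by \<open>C\<close>; the product of the three factors results.
  Requiring positivity in \<open>comparable\<close> admits spine vertices of weight zero.\<close>

lemma controlled_weights_sum:
  fixes P :: "nat \<Rightarrow> 'v wgraph"
  assumes sum: "is_sum_of l \<Gamma> P" and P: "\<And>i. i \<le> l \<Longrightarrow> controlled_weights (P i) C"
    and C: "0 \<le> C" and R: "0 \<le> R"
    and comparable: "\<And>i j x. i \<le> l \<Longrightarrow> j \<le> l \<Longrightarrow> x \<in> verts (P i) \<Longrightarrow> x \<in> verts (P j) \<Longrightarrow>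
      0 < vwt (P i) x \<Longrightarrow> vwt (P j) x \<le> R * vwt (P i) x"
  shows "controlled_weights \<Gamma> ((real l + 1) * R * C)"
    and "i \<le> l \<Longrightarrow> x \<in> verts (P i) \<Longrightarrow> 0 < vwt (P i) x \<Longrightarrow> vwt \<Gamma> x \<le> (real l + 1) * R * vwt (P i) x"
    and "i \<le> l \<Longrightarrow> x \<in> verts (P i) \<Longrightarrow> vwt (P i) x \<le> vwt \<Gamma> x"
    and "i \<le> l \<Longrightarrow> x \<in> verts (P i) \<Longrightarrow> y \<in> verts (P i) \<Longrightarrow> ewt (P i) x y \<le> ewt \<Gamma> x y"
proof -
  have V: "verts \<Gamma> = (\<Union>i\<le>l. verts (P i))" and E: "edges \<Gamma> = (\<Union>i\<le>l. edges (P i))"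
    and vw: "\<And>x. x \<in> verts \<Gamma> \<Longrightarrow> vwt \<Gamma> x = (\<Sum>i\<le>l. if x \<in> verts (P i) then vwt (P i) x else 0)"
    and ew: "\<And>x y. x \<in> verts \<Gamma> \<Longrightarrow> y \<in> verts \<Gamma> \<Longrightarrow> ewt \<Gamma> x y =
      (\<Sum>i\<le>l. if x \<in> verts (P i) \<and> y \<in> verts (P i) then ewt (P i) x y else 0)"
    using sum unfolding is_sum_of_def by blast+
  have vnn: "0 \<le> vwt (P i) x" if "i \<le> l" "x \<in> verts (P i)" for i x
    using P[OF that(1)] that by (simp add: controlled_weights_def)
  have Psimple: "simple_graph (P i)" if "i \<le> l" for i
    using P[OF that] by (simp add: controlled_weights_def)
  have enn: "0 \<le> ewt (P i) x y" if "i \<le> l" "x \<in> verts (P i)" "y \<in> verts (P i)" for i x y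
    using P[OF that(1)] that by (simp add: controlled_weights_def adapted_def)
  have adj: "adj \<Gamma> x y \<longleftrightarrow> (\<exists>i\<le>l. adj (P i) x y)" for x y
    unfolding adj_def E by auto
  show le: "vwt \<Gamma> x \<le> (real l + 1) * R * vwt (P i) x"
    if i: "i \<le> l" "x \<in> verts (P i)" "0 < vwt (P i) x" for i x
  proof -
    have "x \<in> verts \<Gamma>" using i V by blast
    then have "vwt \<Gamma> x = (\<Sum>j\<le>l. if x \<in> verts (P j) then vwt (P j) x else 0)" by (rule vw)
    also have "\<dots> \<le> (\<Sum>j\<le>l. R * vwt (P i) x)"
      using comparable[OF i(1) _ i(2) _ i(3)] R i(3) by (intro sum_mono) auto
    finally show ?thesis by (simp add: algebra_simps)
  qed
  show "vwt (P i) x \<le> vwt \<Gamma> x" if i: "i \<le> l" "x \<in> verts (P i)" for i x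
  proof -
    have "x \<in> verts \<Gamma>" using i V by blast
    have "vwt (P i) x = (if x \<in> verts (P i) then vwt (P i) x else 0)" using i by simp
    also have "\<dots> \<le> (\<Sum>i\<le>l. if x \<in> verts (P i) then vwt (P i) x else 0)"
      using i vnn by (intro member_le_sum) auto
    finally show ?thesis using vw[OF \<open>x \<in> verts \<Gamma>\<close>] by simp
  qed
  show ele: "ewt (P i) x y \<le> ewt \<Gamma> x y" if i: "i \<le> l" "x \<in> verts (P i)" "y \<in> verts (P i)" for i x y
  proof -
    have xy: "x \<in> verts \<Gamma>" "y \<in> verts \<Gamma>" using i V by blast+
    have "ewt (P i) x y = (if x \<in> verts (P i) \<and> y \<in> verts (P i) then ewt (P i) x y else 0)" using i by simp
    also have "\<dots> \<le> (\<Sum>i\<le>l. if x \<in> verts (P i) \<and> y \<in> verts (P i) then ewt (P i) x y else 0)"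
      using i enn by (intro member_le_sum) auto
    finally show ?thesis using ew[OF xy] by simp
  qed
  have simple: "simple_graph \<Gamma>"
    unfolding simple_graph_def
  proof
    fix e assume "e \<in> edges \<Gamma>"
    then obtain i where i: "i \<le> l" "e \<in> edges (P i)" using E by blast
    then obtain x y where "x \<in> verts (P i)" "y \<in> verts (P i)" "x \<noteq> y" "e = {x, y}"
      using Psimple unfolding simple_graph_def by blast
    then show "\<exists>x\<in>verts \<Gamma>. \<exists>y\<in>verts \<Gamma>. x \<noteq> y \<and> e = {x, y}" using V i by blast
  qed
  have "adapted \<Gamma>"
    unfolding adapted_def
  proof (intro ballI conjI)
    fix x y assume xy: "x \<in> verts \<Gamma>" "y \<in> verts \<Gamma>"
    let ?t = "\<lambda>i. if x \<in> verts (P i) \<and> y \<in> verts (P i) then ewt (P i) x y else 0"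
    have "ewt (P i) x y = ewt (P i) y x" if "i \<le> l" "x \<in> verts (P i)" "y \<in> verts (P i)" for i
      using P[OF that(1)] that by (simp add: controlled_weights_def adapted_def)
    then show "ewt \<Gamma> x y = ewt \<Gamma> y x"
      unfolding ew[OF xy] ew[OF xy(2,1)] by (intro sum.cong) auto
    show "0 \<le> ewt \<Gamma> x y" unfolding ew[OF xy] using enn by (intro sum_nonneg) auto
    have "ewt \<Gamma> x y = 0 \<longleftrightarrow> (\<forall>i\<le>l. ?t i = 0)"
      unfolding ew[OF xy] using enn by (subst sum_nonneg_eq_0_iff) auto
    moreover have "?t i \<noteq> 0 \<longleftrightarrow> adj (P i) x y" if "i \<le> l" for i
      using P[OF that] simple_graph_adjD[OF Psimple[OF that]]
      unfolding controlled_weights_def adapted_def by auto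
    ultimately show "(ewt \<Gamma> x y \<noteq> 0) = adj \<Gamma> x y" unfolding adj by blast
  qed
  moreover have "\<forall>x\<in>verts \<Gamma>. 0 \<le> vwt \<Gamma> x"
    using vw vnn by (auto intro!: sum_nonneg)
  moreover have "(\<Sum>y\<in>S. ewt \<Gamma> x y) \<le> vwt \<Gamma> x"
    if x: "x \<in> verts \<Gamma>" and S: "finite S" "S \<subseteq> verts \<Gamma>" for x S
  proof -
    have "(\<Sum>y\<in>S. ewt \<Gamma> x y) =
        (\<Sum>y\<in>S. \<Sum>i\<le>l. if x \<in> verts (P i) \<and> y \<in> verts (P i) then ewt (P i) x y else 0)"
      using ew[OF x] S by (intro sum.cong) auto
    also have "\<dots> = (\<Sum>i\<le>l. \<Sum>y\<in>S. if x \<in> verts (P i) \<and> y \<in> verts (P i) then ewt (P i) x y else 0)"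
      by (rule sum.swap)
    also have "\<dots> \<le> (\<Sum>i\<le>l. if x \<in> verts (P i) then vwt (P i) x else 0)"
    proof (rule sum_mono)
      fix i assume i: "i \<in> {..l}"
      show "(\<Sum>y\<in>S. if x \<in> verts (P i) \<and> y \<in> verts (P i) then ewt (P i) x y else 0)
          \<le> (if x \<in> verts (P i) then vwt (P i) x else 0)"
      proof (cases "x \<in> verts (P i)")
        case True
        then have "(\<Sum>y\<in>S \<inter> verts (P i). ewt (P i) x y) \<le> vwt (P i) x"
          using P[of i] i S(1) unfolding controlled_weights_def by auto
        then show ?thesis using True by (simp add: sum.inter_restrict[OF S(1)])
      qed auto
    qed
    finally show ?thesis using vw[OF x] by simp
  qed
  moreover have "vwt \<Gamma> x \<le> (real l + 1) * R * C * ewt \<Gamma> x y" if xy: "adj \<Gamma> x y" for x y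
  proof -
    obtain i where i: "i \<le> l" "adj (P i) x y" using xy adj by blast
    then have v: "x \<in> verts (P i)" "y \<in> verts (P i)"
      using simple_graph_adjD[OF Psimple] by blast+
    have "vwt \<Gamma> x \<le> (real l + 1) * R * vwt (P i) x"
      using le i v controlled_weights_vwt_pos P by metis
    also have "vwt (P i) x \<le> C * ewt (P i) x y"
      using P i unfolding controlled_weights_def by blast
    also have "ewt (P i) x y \<le> ewt \<Gamma> x y" using ele i v by blast
    finally show ?thesis using R C by (simp add: mult.assoc mult_left_mono)
  qed
  ultimately show "controlled_weights \<Gamma> ((real l + 1) * R * C)"
    using simple unfolding controlled_weights_def by blast
qed

lemma glue_rep_eq_imp_marked:
  assumes "glue_rep G \<phi> i x = glue_rep G \<phi> j y" "i \<noteq> j" "1 \<le> i"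
  shows "x \<in> G i" "\<phi> i x = (if j = 0 then y else \<phi> j y)" "j = 0 \<or> y \<in> G j"
  using assms by (auto simp: glue_rep_def split: if_splits)

lemma gluing_page_decomposition:
  fixes \<Gamma> :: "'v wgraph" and P :: "nat \<Rightarrow> 'v wgraph"
  assumes l: "1 \<le> l" and glue: "obtained_by_gluing l \<Gamma> P"
  shows "\<exists>C K. page_decomposition \<Gamma> C P l K"
proof -
  from glue obtain Q :: "nat \<Rightarrow> 'v wgraph" and G G' \<phi> and q :: "nat \<Rightarrow> 'v \<Rightarrow> 'v" where
    gluing: "spine_graph (Q 0) \<and>
        (\<forall>i\<in>{1..l}. weighted_graph (Q i) \<and> infinite (verts (Q i)) \<and>
           G i \<subseteq> verts (Q i) \<and> G' i \<subseteq> verts (Q 0) \<and> bij_betw (\<phi> i) (G i) (G' i)) \<and>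
        glue_comparable l Q G \<phi> \<and>
        (\<forall>i\<le>l. \<forall>j\<le>l. \<forall>x\<in>verts (Q i). \<forall>y\<in>verts (Q j).
           q i x = q j y \<longleftrightarrow> glue_rep G \<phi> i x = glue_rep G \<phi> j y) \<and>
        (\<forall>i\<le>l. wgraph_iso (q i) (Q i) (P i)) \<and>
        is_sum_of l \<Gamma> P \<and>
        connected_in \<Gamma> (verts \<Gamma>) \<and>
        (\<exists>s>0. connected_in \<Gamma> (nbhd \<Gamma> (verts (P 0)) s)) \<and>
        (\<forall>i\<in>{1..l}. inner_boundary \<Gamma> (verts (P i)) = q i ` G i)"
    unfolding obtained_by_gluing_def by (elim exE) (rule that)
  have spine: "spine_graph (Q 0)" using gluing by (elim conjE)
  have "\<forall>i\<in>{1..l}. weighted_graph (Q i) \<and> infinite (verts (Q i)) \<and>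
      G i \<subseteq> verts (Q i) \<and> G' i \<subseteq> verts (Q 0) \<and> bij_betw (\<phi> i) (G i) (G' i)"
    using gluing by (elim conjE)
  then have pages: "weighted_graph (Q i) \<and> infinite (verts (Q i)) \<and>
      G i \<subseteq> verts (Q i) \<and> G' i \<subseteq> verts (Q 0) \<and> bij_betw (\<phi> i) (G i) (G' i)"
    if "i \<in> {1..l}" for i
    using that by (rule bspec)
  have comp: "glue_comparable l Q G \<phi>" using gluing by (elim conjE)
  have "\<forall>i\<le>l. \<forall>j\<le>l. \<forall>x\<in>verts (Q i). \<forall>y\<in>verts (Q j).
      q i x = q j y \<longleftrightarrow> glue_rep G \<phi> i x = glue_rep G \<phi> j y"
    using gluing by (elim conjE)
  then have rep: "q i x = q j y \<longleftrightarrow> glue_rep G \<phi> i x = glue_rep G \<phi> j y"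
    if "i \<le> l" "j \<le> l" "x \<in> verts (Q i)" "y \<in> verts (Q j)" for i j x y
    using that by simp
  have "\<forall>i\<le>l. wgraph_iso (q i) (Q i) (P i)" using gluing by (elim conjE)
  then have iso: "wgraph_iso (q i) (Q i) (P i)" if "i \<le> l" for i using that by simp
  have sum: "is_sum_of l \<Gamma> P" using gluing by (elim conjE)
  have conn: "connected_in \<Gamma> (verts \<Gamma>)" using gluing by (elim conjE)
  have "\<forall>i\<in>{1..l}. inner_boundary \<Gamma> (verts (P i)) = q i ` G i" using gluing by (elim conjE)
  then have bd: "inner_boundary \<Gamma> (verts (P i)) = q i ` G i" if "i \<in> {1..l}" for i
    using that by (rule bspec)
  have V: "verts \<Gamma> = (\<Union>i\<le>l. verts (P i))" and E: "edges \<Gamma> = (\<Union>i\<le>l. edges (P i))"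
    using sum unfolding is_sum_of_def by blast+
  have im: "verts (P i) = q i ` verts (Q i)" if "i \<le> l" for i
    using iso[OF that] by (simp add: wgraph_iso_def bij_betw_def)
  have vw: "vwt (P i) (q i a) = vwt (Q i) a" if "i \<le> l" "a \<in> verts (Q i)" for i a
    using iso[OF that(1)] that by (simp add: wgraph_iso_def)
  have "\<exists>C\<ge>1. controlled_weights (P i) C" if i: "i \<le> l" for i
  proof -
    have "simple_graph (Q i) \<and> admissible_weights (Q i) \<and> (\<forall>x\<in>verts (Q i). 0 \<le> vwt (Q i) x)"
    proof (cases "i = 0")
      case True
      then show ?thesis using spine unfolding spine_graph_def by fastforce
    next
      case False
      then show ?thesis using pages[of i] i unfolding weighted_graph_def by (auto simp: less_imp_le)
    qed
    then obtain C where "C \<ge> 1" "controlled_weights (Q i) C"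
      using admissible_weights_controlled by blast
    then show ?thesis using controlled_weights_iso[OF iso[OF i]] by blast
  qed
  then obtain c where c: "\<And>i. i \<le> l \<Longrightarrow> c i \<ge> 1 \<and> controlled_weights (P i) (c i)"
    by metis
  define C where "C = (\<Sum>i\<le>l. c i)"
  have cC: "c i \<le> C" if "i \<le> l" for i
    unfolding C_def using that c by (intro member_le_sum) (auto intro: order_trans[of 0 1])
  have C1: "1 \<le> C" using cC[of 0] c[of 0] by simp
  have PC: "controlled_weights (P i) C" if "i \<le> l" for i
    using c cC that controlled_weights_mono by blast
  have pos: "0 < vwt (P i) x" if i: "i \<in> {1..l}" and x: "x \<in> verts (P i)" for i x
  proof -
    obtain a where "a \<in> verts (Q i)" "x = q i a" using im[of i] i x by auto
    then show ?thesis using vw[of i a] pages[OF i] i unfolding weighted_graph_def by auto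
  qed
  \<comment> \<open>A page overlaps any other piece only in marked vertices, and these share a
    partner in the spine. The weight comparison and the treatment of foreign edges both reduce to
    this.\<close>
  have meet: "\<exists>a\<in>G i. x = q i a \<and> \<phi> i a \<in> verts (Q 0) \<and>
      (if j = 0 then x = q 0 (\<phi> i a) else \<exists>b\<in>G j. x = q j b \<and> \<phi> j b = \<phi> i a)"
    if i: "i \<in> {1..l}" and j: "j \<le> l" "i \<noteq> j" and x: "x \<in> verts (P i)" "x \<in> verts (P j)" for i j x
  proof -
    have il: "i \<le> l" using i by simp
    obtain a where a: "a \<in> verts (Q i)" "x = q i a" using im[OF il] x by blast
    obtain b where b: "b \<in> verts (Q j)" "x = q j b" using im[OF j(1)] x by blast
    have "glue_rep G \<phi> i a = glue_rep G \<phi> j b" using rep[OF il j(1) a(1) b(1)] a b by simp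
    note m = glue_rep_eq_imp_marked[OF this j(2)]
    have "a \<in> G i" using m i by simp
    moreover have "\<phi> i a \<in> verts (Q 0)"
      using pages[OF i] \<open>a \<in> G i\<close> bij_betwE by blast
    moreover have "\<exists>b\<in>G j. x = q j b \<and> \<phi> j b = \<phi> i a" if "j \<noteq> 0"
      using m i b that by (intro bexI[of _ b]) auto
    ultimately show ?thesis using m i a b by (intro bexI[of _ a]) auto
  qed
  obtain cI CI where cI: "cI > 0" "CI > 0" and cmp: "\<And>i x. i \<in> {1..l} \<Longrightarrow> x \<in> G i \<Longrightarrow>
        if vwt (Q 0) (\<phi> i x) \<noteq> 0
        then cI * vwt (Q 0) (\<phi> i x) \<le> vwt (Q i) x \<and> vwt (Q i) x \<le> CI * vwt (Q 0) (\<phi> i x)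
        else \<forall>j\<in>{1..l}. \<forall>y\<in>G j. \<phi> j y = \<phi> i x \<longrightarrow>
               cI * vwt (Q j) y \<le> vwt (Q i) x \<and> vwt (Q i) x \<le> CI * vwt (Q j) y"
    using comp unfolding glue_comparable_def by blast
  \<comment> \<open>One bound for all ratios below: \<open>1\<close> within a piece;
    \<open>1 / cI\<close> for spine weight against page weight, and for two page weights over a
    spine vertex of weight zero; \<open>CI\<close> for page weight against spine weight;
    \<open>CI / cI\<close> for two pages compared through the spine.\<close>
  define R where "R = 1 + 1 / cI + CI + CI / cI"
  have R: "1 \<le> R" "1 / cI \<le> R" "CI \<le> R" "CI / cI \<le> R" using cI by (auto simp: R_def)
  have comparable: "vwt (P j) x \<le> R * vwt (P i) x"
    if i: "i \<le> l" and j: "j \<le> l" and x: "x \<in> verts (P i)" "x \<in> verts (P j)" and p: "0 < vwt (P i) x"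
    for i j x
  proof -
    have RI: "vwt (P j) x \<le> R * vwt (P i) x" if "vwt (P j) x \<le> t * vwt (P i) x" "t \<le> R" for t
      using that p mult_right_mono[of t R "vwt (P i) x"] by linarith
    consider "i = j" | "i \<noteq> j" "1 \<le> i" "j = 0" | "i \<noteq> j" "1 \<le> i" "1 \<le> j" | "i = 0" "1 \<le> j"
      by linarith
    then show ?thesis
    proof cases
      case 1
      then show ?thesis using RI[of 1] R by simp
    next
      case 2
      then have il: "i \<in> {1..l}" using i by simp
      obtain a where a: "a \<in> G i" "x = q i a" "\<phi> i a \<in> verts (Q 0)" "x = q 0 (\<phi> i a)"
        using meet[OF il j 2(1) x] 2 by auto
      have aQ: "a \<in> verts (Q i)" using a pages[OF il] by blast
      have vi: "vwt (P i) x = vwt (Q i) a" using vw[OF i aQ] a by simp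
      have vj: "vwt (P j) x = vwt (Q 0) (\<phi> i a)" using vw[OF j, of "\<phi> i a"] a(3) a(4)[symmetric] 2 by simp
      show ?thesis
      proof (cases "vwt (Q 0) (\<phi> i a) = 0")
        case True
        then show ?thesis using vj p R by simp
      next
        case False
        then have "cI * vwt (Q 0) (\<phi> i a) \<le> vwt (Q i) a" using cmp[OF il a(1)] by simp
        then show ?thesis using RI[of "1 / cI"] R cI vi vj by (simp add: field_simps)
      qed
    next
      case 3
      then have il: "i \<in> {1..l}" "j \<in> {1..l}" using i j by simp_all
      obtain a b where a: "a \<in> G i" "x = q i a" "\<phi> i a \<in> verts (Q 0)"
        and b: "b \<in> G j" "x = q j b" "\<phi> j b = \<phi> i a"
        using meet[OF il(1) j 3(1) x] 3 by auto
      have vi: "vwt (P i) x = vwt (Q i) a" using vw[OF i, of a] a pages[OF il(1)] by auto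
      have vj: "vwt (P j) x = vwt (Q j) b" using vw[OF j, of b] b pages[OF il(2)] by auto
      show ?thesis
      proof (cases "vwt (Q 0) (\<phi> i a) = 0")
        case True
        then have "cI * vwt (Q j) b \<le> vwt (Q i) a" using cmp[OF il(1) a(1)] il b by auto
        then show ?thesis using RI[of "1 / cI"] R cI vi vj by (simp add: field_simps)
      next
        case False
        then have "cI * vwt (Q 0) (\<phi> i a) \<le> vwt (Q i) a" using cmp[OF il(1) a(1)] by simp
        then have "CI * vwt (Q 0) (\<phi> i a) \<le> CI / cI * vwt (Q i) a" using cI by (simp add: field_simps)
        moreover have "vwt (Q j) b \<le> CI * vwt (Q 0) (\<phi> i a)" using cmp[OF il(2) b(1)] False b by simp
        ultimately show ?thesis using RI[of "CI / cI"] R vi vj by simp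
      qed
    next
      case 4
      then have jl: "j \<in> {1..l}" using j by simp
      obtain b where b: "b \<in> G j" "x = q j b" "\<phi> j b \<in> verts (Q 0)" "x = q 0 (\<phi> j b)"
        using meet[OF jl i _ x(2,1)] 4 by auto
      have vj: "vwt (P j) x = vwt (Q j) b" using vw[OF j, of b] b pages[OF jl] by auto
      have vi: "vwt (P i) x = vwt (Q 0) (\<phi> j b)" using vw[OF i, of "\<phi> j b"] b(3) b(4)[symmetric] 4 by simp
      \<comment> \<open>Positivity of the spine weight selects the first branch of the comparability
        condition.\<close>
      have "vwt (Q j) b \<le> CI * vwt (Q 0) (\<phi> j b)" using cmp[OF jl b(1)] p vi by simp
      then show ?thesis using RI[of CI] R vi vj by simp
    qed
  qed
  have R0: "0 \<le> R" using R by simp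
  have C0: "0 \<le> C" using C1 by simp
  have S1: "controlled_weights \<Gamma> ((real l + 1) * R * C)"
    by (rule controlled_weights_sum(1)[OF sum PC C0 R0 comparable])
  have S2: "vwt \<Gamma> x \<le> (real l + 1) * R * vwt (P i) x"
    if "i \<le> l" "x \<in> verts (P i)" "0 < vwt (P i) x" for i x
    by (rule controlled_weights_sum(2)[OF sum PC C0 R0 comparable that])
  have S3: "vwt (P i) x \<le> vwt \<Gamma> x" if "i \<le> l" "x \<in> verts (P i)" for i x
    by (rule controlled_weights_sum(3)[OF sum PC C0 R0 comparable that])
  have S4: "ewt (P i) x y \<le> ewt \<Gamma> x y" if "i \<le> l" "x \<in> verts (P i)" "y \<in> verts (P i)" for i x y
    by (rule controlled_weights_sum(4)[OF sum PC C0 R0 comparable that])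
  define K where "K = (real l + 1) * R"
  have K1: "1 \<le> K" using R mult_mono[of 1 "real l + 1" 1 R] by (simp add: K_def)
  \<comment> \<open>A spine vertex may have weight zero in its own piece. Follow a path to the first
    page: with length \<open>0\<close> the vertex lies in that page, otherwise it has an incident
    edge in \<open>\<Gamma>\<close>, and either way its total weight is positive.\<close>
  have vpos: "0 < vwt \<Gamma> x" if x: "x \<in> verts \<Gamma>" for x
  proof -
    have "infinite (verts (Q 1))" using pages[of 1] l by simp
    then obtain b where b: "b \<in> verts (Q 1)" by (metis ex_in_conv finite.emptyI)
    then have u: "q 1 b \<in> verts (P 1)" using im[of 1] l by simp
    then have "q 1 b \<in> verts \<Gamma>" using V l by auto
    then obtain k p where p: "path_in \<Gamma> (verts \<Gamma>) k p" "p 0 = x" "p k = q 1 b"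
      using conn x unfolding connected_in_def joined_in_def by blast
    show ?thesis
    proof (cases "k = 0")
      case True
      then have "x \<in> verts (P 1)" using p u by simp
      then show ?thesis using pos[of 1 x] S3[of 1 x] l by simp
    next
      case False
      then have "adj \<Gamma> x (p 1)" using p unfolding path_in_def by auto
      then show ?thesis by (rule controlled_weights_vwt_pos[OF S1])
    qed
  qed
  have CK: "1 \<le> K * C" using K1 C1 mult_mono[of 1 K 1 C] by simp
  interpret controlled_graph \<Gamma> "K * C"
    using S1 CK conn vpos unfolding K_def by (intro controlled_graphI)
  have "page_decomposition \<Gamma> (K * C) P l K"
  proof
    fix i assume i: "i \<in> {1..l}"
    then have il: "i \<le> l" by simp
    show "verts (P i) \<subseteq> verts \<Gamma>" using V il by blast
    show "inner_boundary \<Gamma> (verts (P i)) \<subseteq> verts (P 0)"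
    proof
      fix x assume "x \<in> inner_boundary \<Gamma> (verts (P i))"
      then obtain a where a: "a \<in> G i" "x = q i a" using bd[OF i] by blast
      have "\<phi> i a \<in> verts (Q 0)" "a \<in> verts (Q i)" using pages[OF i] a bij_betwE by blast+
      moreover have "glue_rep G \<phi> i a = glue_rep G \<phi> 0 (\<phi> i a)"
        using a i by (simp add: glue_rep_def)
      ultimately have "x = q 0 (\<phi> i a)" using rep[OF il, of 0] a by simp
      then show "x \<in> verts (P 0)" using im[of 0] \<open>\<phi> i a \<in> verts (Q 0)\<close> by simp
    qed
    fix x assume x: "x \<in> verts (P i)"
    then have vG: "0 < vwt \<Gamma> x" using vpos V il by blast
    have "vwt (P i) x \<le> vwt \<Gamma> x" using S3 il x by blast
    also have "\<dots> \<le> K * vwt \<Gamma> x" using K1 vG by simp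
    finally show "vwt (P i) x \<le> K * vwt \<Gamma> x" .
    show "vwt \<Gamma> x \<le> K * vwt (P i) x" using S2[OF il x pos[OF i x]] by (simp add: K_def)
    fix y assume y: "y \<in> verts (P i)"
    show e0: "0 \<le> ewt (P i) x y"
      using PC[OF il] x y by (simp add: controlled_weights_def adapted_def)
    have le: "ewt (P i) x y \<le> ewt \<Gamma> x y" using S4 il x y by blast
    also have "\<dots> \<le> K * ewt \<Gamma> x y"
      using K1 le e0 mult_right_mono[of 1 K "ewt \<Gamma> x y"] by simp
    finally show "ewt (P i) x y \<le> K * ewt \<Gamma> x y" .
    assume "adj \<Gamma> x y"
    then obtain j where j: "j \<le> l" "adj (P j) x y" using E unfolding adj_def by blast
    show "adj (P i) x y \<or> x \<in> inner_boundary \<Gamma> (verts (P i))"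
    proof (cases "j = i")
      case False
      \<comment> \<open>An edge contributed by another piece puts \<open>x\<close> in both pieces,
        so \<open>x\<close> is marked, and the marked vertices are the inner boundary.\<close>
      have "x \<in> verts (P j)"
        using simple_graph_adjD[of "P j" x y] PC[OF j(1)] j(2) by (simp add: controlled_weights_def)
      then have "x \<in> q i ` G i" using meet[OF i j(1) _ x] False by blast
      then show ?thesis using bd[OF i] by simp
    qed (use j in simp)
  next
    show "verts \<Gamma> \<subseteq> verts (P 0) \<union> (\<Union>i\<in>{1..l}. verts (P i))"
    proof
      fix x assume "x \<in> verts \<Gamma>"
      then obtain i where "i \<le> l" "x \<in> verts (P i)" using V by blast
      then show "x \<in> verts (P 0) \<union> (\<Union>i\<in>{1..l}. verts (P i))" by (cases "i = 0") auto
    qed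
  qed (use l K1 in auto)
  then show ?thesis by blast
qed

section \<open>Cutting\<close>

lemma cutting_page_decomposition:
  fixes \<Gamma> :: "'v wgraph" and P :: "nat \<Rightarrow> 'v wgraph"
  assumes l: "1 \<le> l" and cut: "obtained_by_cutting l \<Gamma> P"
  shows "\<exists>C K. page_decomposition \<Gamma> C P l K"
proof -
  note cutting = cut[unfolded obtained_by_cutting_def]
  have wg: "weighted_graph \<Gamma>" using cutting by (elim conjE)
  have V0: "verts (P 0) \<subseteq> verts \<Gamma>" using cutting by (elim conjE)
  let ?S = "verts \<Gamma> - verts (P 0)"
  have "\<exists>K :: nat \<Rightarrow> 'v set.
        bij_betw K {1..l} (components_in \<Gamma> (verts \<Gamma> - verts (P 0))) \<and>
        (\<forall>i\<in>{1..l}. infinite (K i) \<and>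
           verts (P i) = K i \<union> {v \<in> verts (P 0). \<exists>y\<in>K i. adj \<Gamma> v y})"
    using cutting by (elim conjE)
  then obtain D where D: "bij_betw D {1..l} (components_in \<Gamma> ?S)"
    and VD: "\<And>i. i \<in> {1..l} \<Longrightarrow> verts (P i) = D i \<union> {v \<in> verts (P 0). \<exists>y\<in>D i. adj \<Gamma> v y}"
    by blast
  have "\<forall>i\<le>l. edges (P i) = {e \<in> edges \<Gamma>. e \<subseteq> verts (P i)}" using cutting by (elim conjE)
  then have E: "edges (P i) = {e \<in> edges \<Gamma>. e \<subseteq> verts (P i)}" if "i \<le> l" for i
    using that by simp
  have "\<forall>i\<in>{1..l}. weighted_graph (P i)" using cutting by (elim conjE)
  then have pw: "weighted_graph (P i)" if "i \<in> {1..l}" for i using that by (rule bspec)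
  have "\<exists>cB>0. \<exists>CB>0. \<forall>i\<le>l.
        (\<forall>x\<in>verts (P i).
           (cB * vwt \<Gamma> x \<le> vwt (P i) x \<and> vwt (P i) x \<le> CB * vwt \<Gamma> x) \<or>
           (i = 0 \<and> nbrs (P 0) x = {} \<and> vwt (P 0) x = 0)) \<and>
        (\<forall>x\<in>verts (P i). \<forall>y\<in>verts (P i).
           cB * ewt \<Gamma> x y \<le> ewt (P i) x y \<and> ewt (P i) x y \<le> CB * ewt \<Gamma> x y)"
    using cutting by (elim conjE)
  then obtain cB CB where B: "cB > 0" "CB > 0"
    and cmp: "\<And>i. i \<le> l \<Longrightarrow>
        (\<forall>x\<in>verts (P i).
           (cB * vwt \<Gamma> x \<le> vwt (P i) x \<and> vwt (P i) x \<le> CB * vwt \<Gamma> x) \<or>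
           (i = 0 \<and> nbrs (P 0) x = {} \<and> vwt (P 0) x = 0)) \<and>
        (\<forall>x\<in>verts (P i). \<forall>y\<in>verts (P i).
           cB * ewt \<Gamma> x y \<le> ewt (P i) x y \<and> ewt (P i) x y \<le> CB * ewt \<Gamma> x y)"
    by blast
  have pos: "\<And>x. x \<in> verts \<Gamma> \<Longrightarrow> 0 < vwt \<Gamma> x" using wg by (simp add: weighted_graph_def)
  have "\<exists>C\<ge>1. controlled_weights \<Gamma> C"
    using wg by (intro admissible_weights_controlled) (auto simp: weighted_graph_def less_imp_le)
  then obtain C where C: "1 \<le> C" "controlled_weights \<Gamma> C" by blast
  interpret controlled_graph \<Gamma> C
    using C wg pos by (intro controlled_graphI) (auto simp: weighted_graph_def)
  have comp: "\<exists>x\<in>?S. D i = {y. joined_in \<Gamma> ?S x y}" if "i \<in> {1..l}" for i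
    using D that unfolding bij_betw_def components_in_def by blast
  have joined_sub: "y \<in> ?S" if "joined_in \<Gamma> ?S x y" for x y
    using that unfolding joined_in_def path_in_def by blast
  have DS: "D i \<subseteq> ?S" if "i \<in> {1..l}" for i
    using comp[OF that] joined_sub by blast
  have joined_step: "joined_in \<Gamma> ?S x y'" if j: "joined_in \<Gamma> ?S x y" and y': "adj \<Gamma> y y'" "y' \<in> ?S" for x y y'
  proof -
    obtain k p where p: "path_in \<Gamma> ?S k p" "p 0 = x" "p k = y" using j unfolding joined_in_def by blast
    have "path_in \<Gamma> ?S (Suc k) (p(Suc k := y'))"
      using p y' unfolding path_in_def by (auto simp: less_Suc_eq le_Suc_eq)
    then show ?thesis using p unfolding joined_in_def by (intro exI[of _ "Suc k"] exI) auto
  qed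
  define K where "K = 1 + 1 / cB + CB"
  have K: "1 \<le> K" "1 / cB \<le> K" "CB \<le> K" using B by (auto simp: K_def)
  have "page_decomposition \<Gamma> C P l K"
  proof
    fix i assume i: "i \<in> {1..l}"
    then have il: "i \<le> l" and i0: "i \<noteq> 0" by auto
    show sub: "verts (P i) \<subseteq> verts \<Gamma>" using VD[OF i] DS[OF i] V0 by blast
    show "inner_boundary \<Gamma> (verts (P i)) \<subseteq> verts (P 0)"
    proof
      fix x assume "x \<in> inner_boundary \<Gamma> (verts (P i))"
      then obtain y where x: "x \<in> verts (P i)" and y: "y \<in> verts \<Gamma>" "y \<notin> verts (P i)" "adj \<Gamma> y x"
        unfolding inner_boundary_def by blast
      \<comment> \<open>If \<open>x\<close> were in the component, its neighbour \<open>y\<close>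
        would be either in the spine and then attached to the page, or off the spine and then in the
        same component. Both contradict that \<open>y\<close> is outside the page.\<close>
      have "x \<notin> D i"
      proof
        assume xD: "x \<in> D i"
        then have "y \<notin> verts (P 0)" using VD[OF i] y by blast
        then have "y \<in> ?S" using y by blast
        moreover have "adj \<Gamma> x y" using y adj_commute by blast
        ultimately have "y \<in> D i" using comp[OF i] xD joined_step by blast
        then show False using VD[OF i] y by blast
      qed
      then show "x \<in> verts (P 0)" using x VD[OF i] by blast
    qed
    fix x assume x: "x \<in> verts (P i)"
    have vG: "0 < vwt \<Gamma> x" using pos sub x by blast
    \<comment> \<open>The zero-weight alternative in \<open>cmp\<close> is reserved for the spine,
      so for a page index the two-sided bound remains.\<close>
    have c: "cB * vwt \<Gamma> x \<le> vwt (P i) x" "vwt (P i) x \<le> CB * vwt \<Gamma> x"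
      using cmp[OF il] x i0 by blast+
    have "CB * vwt \<Gamma> x \<le> K * vwt \<Gamma> x" using K vG by (intro mult_right_mono) auto
    then show "vwt (P i) x \<le> K * vwt \<Gamma> x" using c by linarith
    have "0 < vwt (P i) x" using pw[OF i] x by (simp add: weighted_graph_def)
    then have "1 / cB * vwt (P i) x \<le> K * vwt (P i) x" using K by (intro mult_right_mono) auto
    moreover have "vwt \<Gamma> x \<le> 1 / cB * vwt (P i) x" using c B by (simp add: field_simps)
    ultimately show "vwt \<Gamma> x \<le> K * vwt (P i) x" by linarith
    fix y assume y: "y \<in> verts (P i)"
    show "0 \<le> ewt (P i) x y"
      using pw[OF i] x y by (simp add: weighted_graph_def admissible_weights_def adapted_def)
    have "ewt (P i) x y \<le> CB * ewt \<Gamma> x y" using cmp[OF il] x y by blast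
    also have "\<dots> \<le> K * ewt \<Gamma> x y"
      using K ewt_nonneg[of x y] sub x y by (intro mult_right_mono) auto
    finally show "ewt (P i) x y \<le> K * ewt \<Gamma> x y" .
    assume "adj \<Gamma> x y"
    \<comment> \<open>Pages are induced subgraphs here, so the first alternative always
      holds.\<close>
    then show "adj (P i) x y \<or> x \<in> inner_boundary \<Gamma> (verts (P i))"
      using E[OF il] x y by (simp add: adj_def)
  next
    show "verts \<Gamma> \<subseteq> verts (P 0) \<union> (\<Union>i\<in>{1..l}. verts (P i))"
    proof
      fix x assume x: "x \<in> verts \<Gamma>"
      show "x \<in> verts (P 0) \<union> (\<Union>i\<in>{1..l}. verts (P i))"
      proof (cases "x \<in> verts (P 0)")
        case False
        then have xS: "x \<in> ?S" using x by blast
        then have "{y. joined_in \<Gamma> ?S x y} \<in> components_in \<Gamma> ?S"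
          unfolding components_in_def by (intro CollectI exI[of _ x] conjI refl)
        then have "{y. joined_in \<Gamma> ?S x y} \<in> D ` {1..l}" using D by (simp add: bij_betw_def)
        then obtain i where Di: "{y. joined_in \<Gamma> ?S x y} = D i" and i: "i \<in> {1..l}"
          by (rule imageE)
        have "path_in \<Gamma> ?S 0 (\<lambda>_. x)" using xS by (simp add: path_in_def)
        then have "joined_in \<Gamma> ?S x x" unfolding joined_in_def by blast
        then have "x \<in> D i" unfolding Di[symmetric] by simp
        then have "x \<in> verts (P i)" using VD[OF i] by blast
        then show ?thesis using i by blast
      qed simp
    qed
  qed (use l K in auto)
  then show ?thesis by blast
qed

section \<open>Uniformity and the final choice of constants\<close>

text \<open>The path that witnesses uniformity runs inside \<open>H\<close>, so its length also
  bounds the distance of \<open>H\<close>.\<close>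

lemma uniform_in_gdist_le:
  assumes "uniform_in H \<Gamma>"
  shows "\<exists>CU>0. \<forall>x\<in>verts H. \<forall>y\<in>verts H. real (gdist H x y) \<le> CU * real (gdist \<Gamma> x y)"
proof -
  obtain cu CU where CU: "CU > 0" and paths: "\<forall>x\<in>verts H. \<forall>y\<in>verts H. \<exists>k p.
      path_in H (verts H) k p \<and> p 0 = x \<and> p k = y \<and> real k \<le> CU * real (gdist \<Gamma> x y) \<and>
      (\<forall>j\<le>k. \<forall>w \<in> verts \<Gamma> - verts H.
         real (gdist \<Gamma> (p j) w) \<ge> cu * (1 + real (min j (k - j))))"
    using assms unfolding uniform_in_def by (elim exE conjE) (rule that)
  have "real (gdist H x y) \<le> CU * real (gdist \<Gamma> x y)" if xy: "x \<in> verts H" "y \<in> verts H" for x y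
  proof -
    obtain k p where k: "path_in H (verts H) k p" "p 0 = x" "p k = y" "real k \<le> CU * real (gdist \<Gamma> x y)"
      using bspec[OF bspec[OF paths xy(1)] xy(2)] by (elim exE conjE) (rule that)
    then have "gdist H x y \<le> k" unfolding gdist_def by (intro cInf_lower) auto
    then show ?thesis using k(4) by linarith
  qed
  then show ?thesis using CU by blast
qed

theorem lemma5:
  fixes \<Gamma> :: "'v wgraph" and P :: "nat \<Rightarrow> 'v wgraph" and l :: nat and \<delta> :: real
    and \<Lambda> :: "nat \<Rightarrow> 'v \<Rightarrow> real \<Rightarrow> real \<Rightarrow> real"
  assumes "pages_and_spine l \<Gamma> P"
    and "\<delta> > 0" and "fixed_width l \<Gamma> P \<delta>"
    and "\<And>i. i \<in> {1..l} \<Longrightarrow> uniform_in (P i) \<Gamma>"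
    and "\<And>i. i \<in> {1..l} \<Longrightarrow> relative_FK (P i) (\<Lambda> i)"
  shows "\<exists>a\<^sub>1>0. \<exists>a\<^sub>2>0. \<exists>c\<^sub>1>0. \<exists>c\<^sub>2>0. \<exists>c\<^sub>3>0. \<forall>\<sigma>. page_choice l \<Gamma> P \<sigma> \<longrightarrow>
    relative_FK \<Gamma> (\<lambda>z r \<nu>.
      if \<exists>i\<in>{1..l}. gball \<Gamma> z r \<subseteq> verts (P i)
      then a\<^sub>1 * \<Lambda> (\<sigma> z r) z r (a\<^sub>2 * \<nu>)
      else Lambda_bar l \<Gamma> P \<delta> \<Lambda> c\<^sub>1 c\<^sub>2 c\<^sub>3 z r \<nu>)"
proof -
  have "\<exists>C K. page_decomposition \<Gamma> C P l K"
    using assms(1) gluing_page_decomposition cutting_page_decomposition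
    unfolding pages_and_spine_def by blast
  then obtain C K where "page_decomposition \<Gamma> C P l K" by blast
  then interpret page_decomposition \<Gamma> C P l K .
  have "\<forall>i\<in>{1..l}. \<exists>CU>0. \<forall>x\<in>verts (P i). \<forall>y\<in>verts (P i).
      real (gdist (P i) x y) \<le> CU * real (gdist \<Gamma> x y)"
    using uniform_in_gdist_le assms(4) by blast
  then obtain cu where cu: "\<And>i. i \<in> {1..l} \<Longrightarrow> cu i > 0"
    "\<And>i x y. i \<in> {1..l} \<Longrightarrow> x \<in> verts (P i) \<Longrightarrow> y \<in> verts (P i) \<Longrightarrow>
      real (gdist (P i) x y) \<le> cu i * real (gdist \<Gamma> x y)"
    by (metis (no_types, lifting))
  \<comment> \<open>Each page has its own uniformity constant; they are positive and finitely many,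
    so their sum serves all pages.\<close>
  define CU where "CU = (\<Sum>i\<in>{1..l}. cu i)"
  have le: "cu i \<le> CU" if "i \<in> {1..l}" for i
    unfolding CU_def using that cu(1) by (intro member_le_sum) (auto simp: less_imp_le)
  have CU: "0 < CU" using le[of 1] cu(1)[of 1] page_exists by simp
  interpret paged_graph \<Gamma> C P l K \<delta> CU \<Lambda>
  proof
    fix i x y assume i: "i \<in> {1..l}" and xy: "x \<in> verts (P i)" "y \<in> verts (P i)"
    have "real (gdist (P i) x y) \<le> cu i * real (gdist \<Gamma> x y)" using cu(2) i xy by blast
    also have "\<dots> \<le> CU * real (gdist \<Gamma> x y)" using le[OF i] by (intro mult_right_mono) auto
    finally show "real (gdist (P i) x y) \<le> CU * real (gdist \<Gamma> x y)" .
  qed (use assms CU in auto)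
  let ?a\<^sub>1 = "1 / K\<^sup>2" and ?c\<^sub>1 = "1 / ((1 + 2 * C) ^ nat \<lfloor>\<delta>\<rfloor> * (K\<^sup>2 * (real l + 2)))"
  have K0: "0 < K" and C0: "0 < C" using K_ge_1 C_ge_1 by linarith+
  have a1: "0 < ?a\<^sub>1" using K0 by simp
  have c1: "0 < ?c\<^sub>1"
    using K0 C0 by (intro divide_pos_pos mult_pos_pos zero_less_power add_nonneg_pos) auto
  have c2: "0 < 2 * CU" using CU by simp
  have c3: "0 < K * C ^ nat \<lfloor>\<delta>\<rfloor>" using K0 C0 by simp
  show ?thesis
    by (rule exI[of _ ?a\<^sub>1], rule conjI[OF a1], rule exI[of _ K], rule conjI[OF K0],
        rule exI[of _ ?c\<^sub>1], rule conjI[OF c1], rule exI[of _ "2 * CU"], rule conjI[OF c2],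
        rule exI[of _ "K * C ^ nat \<lfloor>\<delta>\<rfloor>"], rule conjI[OF c3], intro allI impI relative_FK_paged)
qed

end
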